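(* There is a unique morphism $\psi:\mathrm{Dend}\to\mathrm{Mould}$ of anticyclic non-symmetric operads which maps the generator $L$ to $\dfrac{1}{u_1(u_1+u_2)}$ and the generator $R$ to $\dfrac{1}{(u_1+u_2)u_2}$.
   Context: Notation: $u_{i\dots j}=\sum_{i\le k\le j}u_k$. The anticyclic non-symmetric operad $\mathrm{Mould}$: $\mathrm{Mould}(n)$ ($n\ge1$) is the $\mathbb{Q}$-vector space of rational functions with rational coefficients in $u_1,\dots,u_n$; the unit is $1/u_1$; for $f\in\mathrm{Mould}(m)$, $g\in\mathrm{Mould}(n)$, $1\le i\le m$, $f\circ_i g=u_{i\dots i+n-1}f(u_1,\dots,u_{i-1},u_{i\dots i+n-1},u_{i+n},\dots,u_{m+n-1})g(u_i,\dots,u_{i+n-1})$; the cyclic action is $\tau(f)(u_1,\dots,u_n)=f(-u_{1\dots n},u_1,\dots,u_{n-1})$ on $\mathrm{Mould}(n)$. $\mathrm{Dend}$ (the Dendriform operad) is the non-symmetric operad in $\mathbb{Q}$-vector spaces generated by $L,R$ of degree (arity) $2$ with relations $$L\circ_1(L+R)=L\circ_2L,\qquad R\circ_1L=L\circ_2R,\qquad R\circ_1R=R\circ_2(L+R).$$ It is known to be an anticyclic operad, with the cyclic action determined by $\tau(L)=R$, $\tau(R)=-(L+R)$. An anticyclic non-symmetric operad is a non-symmetric operad $P$ with unit $\mathbf 1$ and linear maps $\tau$ on $P(n)$ such that $\tau^{n+1}=\mathrm{id}$ on $P(n)$, $\tau(\mathbf 1)=-\mathbf 1$, and for $f\in P(m)$,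 $g\in P(n)$: $\tau(f\circ_i g)=\tau(f)\circ_{i-1}g$ for $2\le i\le m$ and $\tau(f\circ_1g)=-\tau(g)\circ_n\tau(f)$. Morphisms of anticyclic operads are operad morphisms commuting with $\tau$. *)

theory Defs
  imports
    Complex_Main
    "HOL-Library.Poly_Mapping"
    "HOL-Library.Tree"
    "HOL-Library.FuncSet"
    "HOL-Computational_Algebra.Fraction_Field"
begin

section \<open>Anticyclic non-symmetric operads\<close>

text \<open>
  An operad is given by subspaces \<open>space P n\<close> (for \<open>n \<ge> 1\<close>) of one ambient rational vector space.
  The value of \<open>space P 0\<close> is irrelevant.  Since an element of the ambient space may
  lie in several of the \<open>space P n\<close> (a rational function in \<open>u\<^sub>1\<close> is also one in \<open>u\<^sub>1, u\<^sub>2\<close>), the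
  operations take the arities as arguments: \<open>comp P m n i f g\<close> is \<open>f \<circ>\<^sub>i g\<close> for \<open>f\<close> of arity \<open>m\<close> and
  \<open>g\<close> of arity \<open>n\<close>, and \<open>rot P n f\<close> is \<open>\<tau> f\<close> for \<open>f\<close> of arity \<open>n\<close>.
\<close>

record 'a operad =
  space :: "nat \<Rightarrow> 'a set"
  scale :: "rat \<Rightarrow> 'a \<Rightarrow> 'a"
  unit :: 'a
  comp :: "nat \<Rightarrow> nat \<Rightarrow> nat \<Rightarrow> 'a \<Rightarrow> 'a \<Rightarrow> 'a"

record 'a anticyclic = "'a operad" +
  rot :: "nat \<Rightarrow> 'a \<Rightarrow> 'a"

locale ns_operad = vector_space "scale P"
  for P :: "('a::ab_group_add, 'z) operad_scheme" +
  assumes subspace_space: "1 \<le> n \<Longrightarrow> subspace (space P n)"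
    and unit_closed: "unit P \<in> space P 1"
    and comp_closed: "\<lbrakk>f \<in> space P m; g \<in> space P n; 1 \<le> i; i \<le> m; 1 \<le> n\<rbrakk>
          \<Longrightarrow> comp P m n i f g \<in> space P (m + n - 1)"
    and comp_add_left: "\<lbrakk>f \<in> space P m; f' \<in> space P m; g \<in> space P n; 1 \<le> i; i \<le> m; 1 \<le> n\<rbrakk>
          \<Longrightarrow> comp P m n i (f + f') g = comp P m n i f g + comp P m n i f' g"
    and comp_add_right: "\<lbrakk>f \<in> space P m; g \<in> space P n; g' \<in> space P n; 1 \<le> i; i \<le> m; 1 \<le> n\<rbrakk>
          \<Longrightarrow> comp P m n i f (g + g') = comp P m n i f g + comp P m n i f g'"
    and comp_scale_left: "\<lbrakk>f \<in> space P m; g \<in> space P n; 1 \<le> i; i \<le> m; 1 \<le> n\<rbrakk>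
          \<Longrightarrow> comp P m n i (scale P c f) g = scale P c (comp P m n i f g)"
    and comp_scale_right: "\<lbrakk>f \<in> space P m; g \<in> space P n; 1 \<le> i; i \<le> m; 1 \<le> n\<rbrakk>
          \<Longrightarrow> comp P m n i f (scale P c g) = scale P c (comp P m n i f g)"
    and comp_unit_left: "\<lbrakk>g \<in> space P n; 1 \<le> n\<rbrakk> \<Longrightarrow> comp P 1 n 1 (unit P) g = g"
    and comp_unit_right: "\<lbrakk>f \<in> space P m; 1 \<le> i; i \<le> m\<rbrakk> \<Longrightarrow> comp P m 1 i f (unit P) = f"
    and comp_sequential:
      "\<lbrakk>f \<in> space P l; g \<in> space P m; h \<in> space P n; 1 \<le> i; i \<le> l; 1 \<le> j; j \<le> m; 1 \<le> n\<rbrakk>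
          \<Longrightarrow> comp P (l + m - 1) n (i - 1 + j) (comp P l m i f g) h
            = comp P l (m + n - 1) i f (comp P m n j g h)"
    and comp_parallel:
      "\<lbrakk>f \<in> space P l; g \<in> space P m; h \<in> space P n; 1 \<le> i; i < k; k \<le> l; 1 \<le> m; 1 \<le> n\<rbrakk>
          \<Longrightarrow> comp P (l + m - 1) n (k - 1 + m) (comp P l m i f g) h
            = comp P (l + n - 1) m i (comp P l n k f h) g"

locale anticyclic_operad = ns_operad P
  for P :: "('a::ab_group_add, 'z) anticyclic_scheme" +
  assumes rot_closed: "\<lbrakk>f \<in> space P n; 1 \<le> n\<rbrakk> \<Longrightarrow> rot P n f \<in> space P n"
    and rot_add: "\<lbrakk>f \<in> space P n; g \<in> space P n; 1 \<le> n\<rbrakk> \<Longrightarrow> rot P n (f + g) = rot P n f + rot P n g"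
    and rot_scale: "\<lbrakk>f \<in> space P n; 1 \<le> n\<rbrakk> \<Longrightarrow> rot P n (scale P c f) = scale P c (rot P n f)"
    and rot_order: "\<lbrakk>f \<in> space P n; 1 \<le> n\<rbrakk> \<Longrightarrow> (rot P n ^^ (n + 1)) f = f"
    and rot_unit: "rot P 1 (unit P) = - unit P"
    and rot_comp: "\<lbrakk>f \<in> space P m; g \<in> space P n; 2 \<le> i; i \<le> m; 1 \<le> n\<rbrakk>
          \<Longrightarrow> rot P (m + n - 1) (comp P m n i f g) = comp P m n (i - 1) (rot P m f) g"
    and rot_comp_1: "\<lbrakk>f \<in> space P m; g \<in> space P n; 1 \<le> m; 1 \<le> n\<rbrakk>
          \<Longrightarrow> rot P (m + n - 1) (comp P m n 1 f g) = - comp P n m n (rot P n g) (rot P m f)"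

text \<open>
  The family \<open>\<psi> n\<close>, \<open>n \<ge> 1\<close>, is taken to be extensional, so that equality of morphisms is
  equality of families of maps \<open>space P n \<rightarrow> space Q n\<close>.
\<close>

locale ns_operad_morphism = source: ns_operad P + target: ns_operad Q
  for P :: "('a::ab_group_add, 'y) operad_scheme"
    and Q :: "('b::ab_group_add, 'z) operad_scheme" +
  fixes \<psi> :: "nat \<Rightarrow> 'a \<Rightarrow> 'b"
  assumes maps: "\<psi> \<in> (\<Pi>\<^sub>E n\<in>{1..}. space P n \<rightarrow>\<^sub>E space Q n)"
    and map_add: "\<lbrakk>1 \<le> n; f \<in> space P n; g \<in> space P n\<rbrakk> \<Longrightarrow> \<psi> n (f + g) = \<psi> n f + \<psi> n g"
    and map_scale: "\<lbrakk>1 \<le> n; f \<in> space P n\<rbrakk> \<Longrightarrow> \<psi> n (scale P c f) = scale Q c (\<psi> n f)"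
    and map_unit: "\<psi> 1 (unit P) = unit Q"
    and map_comp: "\<lbrakk>f \<in> space P m; g \<in> space P n; 1 \<le> i; i \<le> m; 1 \<le> n\<rbrakk>
          \<Longrightarrow> \<psi> (m + n - 1) (comp P m n i f g) = comp Q m n i (\<psi> m f) (\<psi> n g)"

locale anticyclic_operad_morphism =
  ns_operad_morphism P Q \<psi> + source: anticyclic_operad P + target: anticyclic_operad Q
  for P :: "('a::ab_group_add, 'y) anticyclic_scheme"
    and Q :: "('b::ab_group_add, 'z) anticyclic_scheme"
    and \<psi> +
  assumes map_rot: "\<lbrakk>1 \<le> n; f \<in> space P n\<rbrakk> \<Longrightarrow> \<psi> n (rot P n f) = rot Q n (\<psi> n f)"


section \<open>The operad Mould\<close>

text \<open>
  Polynomials and rational functions over the rationals in variables \<open>u\<^sub>0, u\<^sub>1, \<dots>\<close>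
  (\<open>u\<^sub>0\<close> is not used); a monomial is its finitely supported exponent function.
\<close>

type_synonym mpoly = "(nat \<Rightarrow>\<^sub>0 nat) \<Rightarrow>\<^sub>0 rat"

type_synonym ratfun = "mpoly fract"

definition const :: "rat \<Rightarrow> ratfun"
  where "const c = Fract (Poly_Mapping.single 0 c) 1"

definition u :: "nat \<Rightarrow> ratfun"
  where "u k = Fract (Poly_Mapping.single (Poly_Mapping.single k 1) 1) 1"

definition usum :: "nat \<Rightarrow> nat \<Rightarrow> ratfun"
  where "usum i j = (\<Sum>k=i..j. u k)"

definition vars :: "mpoly \<Rightarrow> nat set"
  where "vars p = (\<Union>m\<in>Poly_Mapping.keys p. Poly_Mapping.keys m)"

definition eval_mpoly :: "(nat \<Rightarrow> ratfun) \<Rightarrow> mpoly \<Rightarrow> ratfun"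
  where "eval_mpoly \<sigma> p = (\<Sum>m\<in>Poly_Mapping.keys p. const (Poly_Mapping.lookup p m) *
    (\<Prod>k\<in>Poly_Mapping.keys m. \<sigma> k ^ Poly_Mapping.lookup m k))"

text \<open>
  The rational function \<open>f(\<sigma> 0, \<sigma> 1, \<dots>)\<close>.  The value does not depend on the representation
  \<open>p / q\<close> of \<open>f\<close>; it is specified whenever some representation has a denominator that does
  not vanish at \<open>\<sigma>\<close>.
\<close>

definition subst :: "(nat \<Rightarrow> ratfun) \<Rightarrow> ratfun \<Rightarrow> ratfun"
  where "subst \<sigma> f = (THE h. \<exists>p q. f = Fract p q \<and> eval_mpoly \<sigma> q \<noteq> 0 \<and>
    h = eval_mpoly \<sigma> p / eval_mpoly \<sigma> q)"

definition mould_space :: "nat \<Rightarrow> ratfun set"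
  where "mould_space n = {Fract p q | p q. q \<noteq> 0 \<and> vars p \<subseteq> {1..n} \<and> vars q \<subseteq> {1..n}}"

definition mould_comp :: "nat \<Rightarrow> nat \<Rightarrow> nat \<Rightarrow> ratfun \<Rightarrow> ratfun \<Rightarrow> ratfun"
  where "mould_comp m n i f g = usum i (i + n - 1) *
    subst (\<lambda>k. if k < i then u k else if k = i then usum i (i + n - 1) else u (k + n - 1)) f *
    subst (\<lambda>k. u (k + i - 1)) g"

definition mould_rot :: "nat \<Rightarrow> ratfun \<Rightarrow> ratfun"
  where "mould_rot n f =
    subst (\<lambda>k. if k = 1 then - usum 1 n else if 2 \<le> k \<and> k \<le> n then u (k - 1) else u k) f"

definition Mould :: "ratfun anticyclic"
  where "Mould = \<lparr>space = mould_space, scale = (\<lambda>c f. const c * f), unit = 1 / u 1,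
    comp = mould_comp, rot = mould_rot\<rparr>"


section \<open>The operad Dend\<close>

subsection \<open>The free operad on two binary generators\<close>

text \<open>
  A basis of the free non-symmetric operad on two generators of arity 2 is given by the planar
  binary trees with inner vertices labelled by the generators; the arity is the number of
  leaves.
\<close>

datatype dgen = Gen_L | Gen_R

type_synonym dtree = "dgen tree"

type_synonym free = "dtree \<Rightarrow>\<^sub>0 rat"

fun graft :: "nat \<Rightarrow> dtree \<Rightarrow> dtree \<Rightarrow> dtree"
  where
    "graft i \<langle>\<rangle> s = s"
  | "graft i \<langle>l, x, r\<rangle> s =
      (if i \<le> size1 l then \<langle>graft i l s, x, r\<rangle> else \<langle>l, x, graft (i - size1 l) r s\<rangle>)"

abbreviation basis :: "dtree \<Rightarrow> free"
  where "basis t \<equiv> Poly_Mapping.single t 1"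

definition free_scale :: "rat \<Rightarrow> free \<Rightarrow> free"
  where "free_scale c x = Poly_Mapping.map ((*) c) x"

definition free_space :: "nat \<Rightarrow> free set"
  where "free_space n = {x. \<forall>t\<in>Poly_Mapping.keys x. size1 t = n}"

definition lin_ext :: "(dtree \<Rightarrow> free) \<Rightarrow> free \<Rightarrow> free"
  where "lin_ext b x = (\<Sum>t\<in>Poly_Mapping.keys x. free_scale (Poly_Mapping.lookup x t) (b t))"

text \<open>
  The composition is extended bilinearly from trees, where \<open>t \<circ>\<^sub>i s\<close> is \<open>0\<close> if
  \<open>i\<close> is not the position of a leaf of \<open>t\<close>.
\<close>

definition free_comp :: "nat \<Rightarrow> free \<Rightarrow> free \<Rightarrow> free"
  where "free_comp i x y =
    lin_ext (\<lambda>t. lin_ext (\<lambda>s. if 1 \<le> i \<and> i \<le> size1 t then basis (graft i t s) else 0) y) x"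

abbreviation corolla :: "dgen \<Rightarrow> free"
  where "corolla x \<equiv> basis \<langle>\<langle>\<rangle>, x, \<langle>\<rangle>\<rangle>"

abbreviation free_L :: free where "free_L \<equiv> corolla Gen_L"
abbreviation free_R :: free where "free_R \<equiv> corolla Gen_R"

text \<open>
  The tree \<open>\<langle>l, x, r\<rangle>\<close> is \<open>(x \<circ>\<^sub>2 r) \<circ>\<^sub>1 l\<close>, so the anticyclic axioms force
  \<open>\<tau> \<langle>l, x, r\<rangle> = - (\<tau> l \<circ>\<^sub>k \<tau> (x \<circ>\<^sub>2 r)) = - (\<tau> l \<circ>\<^sub>k (\<tau> x \<circ>\<^sub>1 r))\<close> where \<open>k\<close> is the arity of \<open>l\<close>.
\<close>

fun gen_rot :: "dgen \<Rightarrow> free"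
  where
    "gen_rot Gen_L = free_R"
  | "gen_rot Gen_R = - (free_L + free_R)"

fun tree_rot :: "dtree \<Rightarrow> free"
  where
    "tree_rot \<langle>\<rangle> = - basis \<langle>\<rangle>"
  | "tree_rot \<langle>l, x, r\<rangle> =
      - free_comp (size1 l) (tree_rot l) (free_comp 1 (gen_rot x) (basis r))"

definition free_rot :: "free \<Rightarrow> free"
  where "free_rot = lin_ext tree_rot"


subsection \<open>The dendriform relations\<close>

text \<open>
  The operadic ideal generated by the dendriform relations.  Compositions at a position that is
  not available are \<open>0\<close>, so closing under \<open>free_comp i\<close> for all \<open>i\<close> and all (possibly
  inhomogeneous) elements gives the direct sum of the arity components of that ideal.
\<close>

inductive_set dend_ideal :: "free set"
  where
    rel1: "free_comp 1 free_L (free_L + free_R) - free_comp 2 free_L free_L \<in> dend_ideal"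
  | rel2: "free_comp 1 free_R free_L - free_comp 2 free_L free_R \<in> dend_ideal"
  | rel3: "free_comp 1 free_R free_R - free_comp 2 free_R (free_L + free_R) \<in> dend_ideal"
  | add: "x \<in> dend_ideal \<Longrightarrow> y \<in> dend_ideal \<Longrightarrow> x + y \<in> dend_ideal"
  | scale: "x \<in> dend_ideal \<Longrightarrow> free_scale c x \<in> dend_ideal"
  | comp_left: "x \<in> dend_ideal \<Longrightarrow> free_comp i x y \<in> dend_ideal"
  | comp_right: "x \<in> dend_ideal \<Longrightarrow> free_comp i y x \<in> dend_ideal"

definition dend_rel :: "free \<Rightarrow> free \<Rightarrow> bool"
  where "dend_rel x y \<longleftrightarrow> x - y \<in> dend_ideal"


subsection \<open>Properties of the free operad\<close>

lemma lookup_free_scale [simp]: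
  "Poly_Mapping.lookup (free_scale c x) t = c * Poly_Mapping.lookup x t"
  by (simp add: free_scale_def Poly_Mapping.map.rep_eq when_def)

interpretation free: vector_space free_scale
  by unfold_locales (auto intro!: poly_mapping_eqI simp: lookup_add algebra_simps)

interpretation free2: vector_space_pair free_scale free_scale ..

lemma linear_freeI:
  assumes "\<And>x y. f (x + y) = f x + f y" "\<And>c x. f (free_scale c x) = free_scale c (f x)"
  shows "Vector_Spaces.linear free_scale free_scale f"
  by unfold_locales (use assms in auto)

lemma free_expand: "x = (\<Sum>t\<in>Poly_Mapping.keys x. free_scale (Poly_Mapping.lookup x t) (basis t))"
proof (rule poly_mapping_eqI)
  fix s
  show "Poly_Mapping.lookup x s =
    Poly_Mapping.lookup (\<Sum>t\<in>Poly_Mapping.keys x. free_scale (Poly_Mapping.lookup x t) (basis t)) s"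
    by (simp add: lookup_sum lookup_single when_def in_keys_iff if_distrib cong: if_cong)
qed

lemma lin_ext_superset:
  assumes "finite A" "Poly_Mapping.keys x \<subseteq> A"
  shows "lin_ext b x = (\<Sum>t\<in>A. free_scale (Poly_Mapping.lookup x t) (b t))"
  unfolding lin_ext_def
  by (rule sum.mono_neutral_left) (use assms in \<open>auto simp: in_keys_iff\<close>)

lemma linear_lin_ext: "Vector_Spaces.linear free_scale free_scale (lin_ext b)"
proof (rule linear_freeI)
  fix x y :: free
  show "lin_ext b (x + y) = lin_ext b x + lin_ext b y"
    using keys_add[of x y]
    by (simp add: lin_ext_superset[where A = "Poly_Mapping.keys x \<union> Poly_Mapping.keys y"]
        lookup_add free.scale_left_distrib sum.distrib)
next
  fix c and x :: free
  have "Poly_Mapping.keys (free_scale c x) \<subseteq> Poly_Mapping.keys x"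
    by (auto simp: in_keys_iff)
  then show "lin_ext b (free_scale c x) = free_scale c (lin_ext b x)"
    by (simp add: lin_ext_superset[where A = "Poly_Mapping.keys x"] free.scale_sum_right)
qed

lemma lin_ext_basis [simp]: "lin_ext b (basis t) = b t"
  by (simp add: lin_ext_def lookup_single)

lemma lin_ext_fun_linear:
  "lin_ext (\<lambda>t. b t + c t) x = lin_ext b x + lin_ext c x"
  "lin_ext (\<lambda>t. free_scale r (b t)) x = free_scale r (lin_ext b x)"
  by (simp_all add: lin_ext_def free.scale_right_distrib sum.distrib free.scale_sum_right mult.commute)

lemma linear_comp_left: "Vector_Spaces.linear free_scale free_scale (\<lambda>x. free_comp i x y)"
  unfolding free_comp_def by (rule linear_lin_ext)

lemma linear_comp_right: "Vector_Spaces.linear free_scale free_scale (\<lambda>y. free_comp i x y)"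
  unfolding free_comp_def
  by (rule linear_freeI)
    (simp_all add: free2.linear_add[OF linear_lin_ext] free2.linear_scale[OF linear_lin_ext] lin_ext_fun_linear)

lemma linear_free_rot: "Vector_Spaces.linear free_scale free_scale free_rot"
  unfolding free_rot_def by (rule linear_lin_ext)

lemmas fc_simps = 
  free2.linear_add[OF linear_comp_left] free2.linear_scale[OF linear_comp_left]
  free2.linear_neg[OF linear_comp_left] free2.linear_diff[OF linear_comp_left]
  free2.linear_0[OF linear_comp_left]
  free2.linear_add[OF linear_comp_right] free2.linear_scale[OF linear_comp_right]
  free2.linear_neg[OF linear_comp_right] free2.linear_diff[OF linear_comp_right]
  free2.linear_0[OF linear_comp_right]

lemmas fr_simps = 
  free2.linear_add[OF linear_free_rot] free2.linear_scale[OF linear_free_rot]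
  free2.linear_neg[OF linear_free_rot] free2.linear_diff[OF linear_free_rot]
  free2.linear_0[OF linear_free_rot]

lemma free_rot_basis [simp]: "free_rot (basis t) = tree_rot t"
  by (simp add: free_rot_def)

lemma free_comp_basis:
  "free_comp i (basis t) (basis s) = (if 1 \<le> i \<and> i \<le> size1 t then basis (graft i t s) else 0)"
  by (simp add: free_comp_def)

lemma free_space_induct [consumes 1, case_names zero add basis]:
  assumes "x \<in> free_space n"
    and zero: "P 0"
    and add: "\<And>x y. x \<in> free_space n \<Longrightarrow> y \<in> free_space n \<Longrightarrow> P x \<Longrightarrow> P y \<Longrightarrow> P (x + y)"
    and basis: "\<And>c t. size1 t = n \<Longrightarrow> P (free_scale c (basis t))"
  shows "P x"
proof -
  have b: "free_scale c (basis t) \<in> free_space n" if "size1 t = n" for c t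
    using that by (auto simp: free_space_def in_keys_iff lookup_single when_def split: if_splits)
  have "finite A \<Longrightarrow> A \<subseteq> {t. size1 t = n} \<Longrightarrow>
      (\<Sum>t\<in>A. free_scale (f t) (basis t)) \<in> free_space n \<and>
      P (\<Sum>t\<in>A. free_scale (f t) (basis t))" for A f
  proof (induction A rule: finite_induct)
    case empty
    then show ?case by (simp add: zero free_space_def)
  next
    case (insert t A)
    have "x + y \<in> free_space n" if "x \<in> free_space n" "y \<in> free_space n" for x y
      using that keys_add[of x y] by (auto simp: free_space_def)
    with insert b[of t] add basis[of t] show ?case by simp
  qed
  from this[of "Poly_Mapping.keys x" "Poly_Mapping.lookup x"] assms(1) free_expand[of x]
  show ?thesis by (auto simp: free_space_def)
qed

lemma free_induct [case_names zero add basis]: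
  assumes zero: "P 0"
    and add: "\<And>x y. P x \<Longrightarrow> P y \<Longrightarrow> P (x + y)"
    and basis: "\<And>c t. P (free_scale c (basis t))"
  shows "P x"
proof -
  have "finite A \<Longrightarrow> P (\<Sum>t\<in>A. free_scale (f t) (basis t))" for A f
    by (induction A rule: finite_induct) (auto simp: zero add basis)
  from this[of "Poly_Mapping.keys x" "Poly_Mapping.lookup x"] free_expand[of x]
  show ?thesis by simp
qed

lemma subspace_free_space: "free.subspace (free_space n)"
  unfolding free.subspace_def
  using keys_add by (fastforce simp: free_space_def in_keys_iff)

lemmas fs_closed = free.subspace_0[OF subspace_free_space] free.subspace_add[OF subspace_free_space]
  free.subspace_scale[OF subspace_free_space] free.subspace_neg[OF subspace_free_space]
  free.subspace_diff[OF subspace_free_space]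

lemma basis_in_space [simp]: "basis t \<in> free_space (size1 t)"
  by (simp add: free_space_def)

lemma size1_pos [simp]: "0 < size1 (t :: dtree)" "Suc 0 \<le> size1 t" "size1 t \<noteq> 0"
  by (cases t; simp add: Suc_le_eq size1_ge0)+

lemma size1_graft:
  "\<lbrakk>1 \<le> i; i \<le> size1 t\<rbrakk> \<Longrightarrow> size1 (graft i t s) = size1 t + size1 s - 1"
proof (induction t arbitrary: i)
  case (Node l x r)
  then show ?case
    using size1_pos(1)[of s] size1_pos(1)[of l] size1_pos(1)[of r]
    by (cases "i \<le> size1 l") auto
qed simp

lemma graft_sequential:
  "\<lbrakk>1 \<le> i; i \<le> size1 t; 1 \<le> j; j \<le> size1 s\<rbrakk>
    \<Longrightarrow> graft (i - 1 + j) (graft i t s) r = graft i t (graft j s r)"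
proof (induction t arbitrary: i)
  case (Node l x m)
  show ?case
  proof (cases "i \<le> size1 l")
    case True
    with Node size1_graft[of i l s] show ?thesis by auto
  next
    case False
    with Node.prems have "i - 1 + j - size1 l = (i - size1 l) - 1 + j" using False by simp
    moreover have "graft ((i - size1 l) - 1 + j) (graft (i - size1 l) m s) r = graft (i - size1 l) m (graft j s r)"
      using False Node.prems by (intro Node.IH(2)) auto
    ultimately show ?thesis using False Node.prems by auto
  qed
qed simp

lemma graft_parallel:
  "\<lbrakk>1 \<le> i; i < k; k \<le> size1 t\<rbrakk>
    \<Longrightarrow> graft (k - 1 + size1 s) (graft i t s) r = graft i (graft k t r) s"
proof (induction t arbitrary: i k)
  case (Node l x m)
  consider "k \<le> size1 l" | "i \<le> size1 l" "size1 l < k" | "size1 l < i"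
    using Node.prems by linarith
  then show ?case
  proof cases
    case 1
    with Node size1_graft[of i l s] size1_graft[of k l r] size1_pos(1)[of r] show ?thesis by auto
  next
    case 2
    have "k - 1 + size1 s - (size1 l + size1 s - 1) = k - size1 l"
      using 2 size1_pos(1)[of l] by simp
    with 2 Node size1_graft[of i l s] size1_pos(1)[of l] size1_pos(1)[of s] show ?thesis by auto
  next
    case 3
    have "k - 1 + size1 s - size1 l = k - size1 l - 1 + size1 s" using 3 Node.prems by simp
    moreover have "graft (k - size1 l - 1 + size1 s) (graft (i - size1 l) m s) r =
        graft (i - size1 l) (graft (k - size1 l) m r) s"
      using 3 Node.prems by (intro Node.IH(2)) auto
    ultimately show ?thesis using 3 Node.prems size1_pos(1)[of s] by auto
  qed
qed simp

lemma free_comp_closed: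
  assumes "x \<in> free_space m" "y \<in> free_space n"
  shows "free_comp i x y \<in> free_space (m + n - 1)"
  using assms
proof (induction x rule: free_space_induct)
  case (basis c t)
  from basis(2) show ?case
  proof (induction y rule: free_space_induct)
    case (basis d s)
    have "free_comp i (basis t) (basis s) \<in> free_space (m + n - 1)"
      using \<open>size1 t = m\<close> basis(1) basis_in_space[of "graft i t s"] size1_graft[of i t s]
      by (auto simp: free_comp_basis fs_closed simp del: basis_in_space)
    then show ?case by (simp add: fc_simps fs_closed)
  qed (simp_all add: fc_simps fs_closed)
qed (simp_all add: fc_simps fs_closed)

lemma free_sequential:
  assumes "x \<in> free_space l" "y \<in> free_space m" "1 \<le> i" "i \<le> l" "1 \<le> j" "j \<le> m"
  shows "free_comp (i - 1 + j) (free_comp i x y) z = free_comp i x (free_comp j y z)"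
  using assms(1)
proof (induction x rule: free_space_induct)
  case (basis c t)
  from assms(2) show ?case
  proof (induction y rule: free_space_induct)
    case (basis d s)
    show ?case
    proof (induction z rule: free_induct)
      case (basis e r)
      have "free_comp (i - 1 + j) (free_comp i (basis t) (basis s)) (basis r) =
          free_comp i (basis t) (free_comp j (basis s) (basis r))"
        using \<open>size1 t = l\<close> \<open>size1 s = m\<close> assms
        using graft_sequential[of i t j s r] by (auto simp: free_comp_basis size1_graft)
      then show ?case by (simp add: fc_simps)
    qed (auto simp: fc_simps free.scale_right_distrib free.scale_right_diff_distrib)
  qed (auto simp: fc_simps free.scale_right_distrib free.scale_right_diff_distrib)
qed (auto simp: fc_simps free.scale_right_distrib free.scale_right_diff_distrib)

lemma free_parallel:
  assumes "x \<in> free_space l" "y \<in> free_space m" "z \<in> free_space n" "1 \<le> i" "i < k" "k \<le> l"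
  shows "free_comp (k - 1 + m) (free_comp i x y) z = free_comp i (free_comp k x z) y"
  using assms(1)
proof (induction x rule: free_space_induct)
  case (basis c t)
  from assms(2) show ?case
  proof (induction y rule: free_space_induct)
    case (basis d s)
    from assms(3) show ?case
    proof (induction z rule: free_space_induct)
      case (basis e r)
      have "free_comp (k - 1 + m) (free_comp i (basis t) (basis s)) (basis r) =
          free_comp i (free_comp k (basis t) (basis r)) (basis s)"
        using \<open>size1 t = l\<close> \<open>size1 s = m\<close> assms size1_pos(1)[of r] size1_pos(1)[of s]
        using graft_parallel[of i k t s r] by (auto simp: free_comp_basis size1_graft)
      then show ?case by (simp add: fc_simps)
    qed (auto simp: fc_simps free.scale_right_distrib free.scale_right_diff_distrib)
  qed (auto simp: fc_simps free.scale_right_distrib free.scale_right_diff_distrib)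
qed (auto simp: fc_simps free.scale_right_distrib free.scale_right_diff_distrib)

lemma graft_Leaf: "graft i t \<langle>\<rangle> = t"
  by (induction t arbitrary: i) auto

lemma free_comp_unit_left: "free_comp 1 (basis \<langle>\<rangle>) y = y"
  by (induction y rule: free_induct) (simp_all add: fc_simps free_comp_basis)

lemma free_comp_unit_right:
  assumes "x \<in> free_space m" "1 \<le> i" "i \<le> m"
  shows "free_comp i x (basis \<langle>\<rangle>) = x"
  using assms(1)
  by (induction x rule: free_space_induct)
    (use assms in \<open>simp_all add: fc_simps free_comp_basis graft_Leaf\<close>)

lemma gen_rot_closed: "gen_rot x \<in> free_space 2"
proof -
  have "corolla y \<in> free_space 2" for y by (simp add: free_space_def)
  then show ?thesis by (cases x) (simp_all del: minus_add_distrib add: fs_closed)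
qed

lemma tree_rot_closed: "tree_rot t \<in> free_space (size1 t)"
proof (induction t)
  case Leaf
  show ?case using basis_in_space[of "\<langle>\<rangle>"] by (simp add: fs_closed del: basis_in_space)
next
  case (Node l x r)
  have "free_comp 1 (gen_rot x) (basis r) \<in> free_space (2 + size1 r - 1)"
    by (intro free_comp_closed gen_rot_closed basis_in_space)
  from free_comp_closed[OF Node.IH(1) this, of "size1 l"] size1_pos(1)[of r]
  show ?case by (simp add: fs_closed)
qed

lemma free_rot_closed: "x \<in> free_space n \<Longrightarrow> free_rot x \<in> free_space n"
proof (induction x rule: free_space_induct)
  case (basis c t)
  then show ?case using tree_rot_closed[of t] by (simp add: fr_simps fs_closed)
qed (simp_all add: fr_simps fs_closed)

lemma tree_rot_graft_1:
  "tree_rot (graft 1 t s) = - free_comp (size1 s) (tree_rot s) (tree_rot t)"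
proof (induction t)
  case Leaf
  show ?case
    using free_comp_unit_right[OF tree_rot_closed, of "size1 s" s] by (simp add: fc_simps)
next
  case (Node l x r)
  have "tree_rot (graft 1 \<langle>l, x, r\<rangle> s) =
    - free_comp (size1 s - 1 + size1 l) (- free_comp (size1 s) (tree_rot s) (tree_rot l))
        (free_comp 1 (gen_rot x) (basis r))"
    using Node.IH(1) size1_graft[of 1 l s] size1_pos(1)[of l] size1_pos(1)[of s] by (simp add: add.commute)
  also have "\<dots> = - free_comp (size1 s) (tree_rot s) (tree_rot \<langle>l, x, r\<rangle>)"
    using free_sequential[OF tree_rot_closed tree_rot_closed, of "size1 s" s "size1 l" l]
    by (simp add: fc_simps)
  finally show ?case .
qed

lemma tree_rot_graft:
  "\<lbrakk>2 \<le> i; i \<le> size1 t\<rbrakk> \<Longrightarrow> tree_rot (graft i t s) = free_comp (i - 1) (tree_rot t) (basis s)"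
proof (induction t arbitrary: i)
  case (Node l x r)
  let ?G = "\<lambda>r. free_comp 1 (gen_rot x) (basis r)"
  have G: "?G r \<in> free_space (size1 r + 1)"
    using free_comp_closed[OF gen_rot_closed basis_in_space, of 1 x r] by simp
  show ?case
  proof (cases "i \<le> size1 l")
    case True
    have "tree_rot (graft i \<langle>l, x, r\<rangle> s) =
       - free_comp (size1 l - 1 + size1 s) (free_comp (i - 1) (tree_rot l) (basis s)) (?G r)"
      using Node True size1_graft[of i l s] by simp
    also have "\<dots> = - free_comp (i - 1) (free_comp (size1 l) (tree_rot l) (?G r)) (basis s)"
      by (subst free_parallel[OF tree_rot_closed basis_in_space G]) (use True Node.prems in auto)
    finally show ?thesis by (simp add: fc_simps)
  next
    case False
    define j where "j = i - size1 l"
    have j: "1 \<le> j" "j \<le> size1 r" "i = size1 l + j" using False Node.prems by (auto simp: j_def)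
    have "tree_rot (graft i \<langle>l, x, r\<rangle> s) = - free_comp (size1 l) (tree_rot l) (?G (graft j r s))"
      using False by (simp add: j_def)
    also have "?G (graft j r s) = free_comp j (?G r) (basis s)"
      using free_sequential[OF gen_rot_closed basis_in_space, of 1 j r x "basis s"] j
      by (simp add: free_comp_basis)
    also have "free_comp (size1 l) (tree_rot l) \<dots> =
        free_comp (size1 l - 1 + j) (free_comp (size1 l) (tree_rot l) (?G r)) (basis s)"
      by (subst free_sequential[OF tree_rot_closed G]) (use j in auto)
    finally show ?thesis using j by (simp add: fc_simps)
  qed
qed simp

lemma free_rot_comp:
  assumes "x \<in> free_space m" "2 \<le> i" "i \<le> m"
  shows "free_rot (free_comp i x y) = free_comp (i - 1) (free_rot x) y"
  using assms(1)
proof (induction x rule: free_space_induct)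
  case (basis c t)
  show ?case
  proof (induction y rule: free_induct)
    case (basis d s)
    have "free_rot (free_comp i (basis t) (basis s)) = free_comp (i - 1) (free_rot (basis t)) (basis s)"
      using \<open>size1 t = m\<close> assms by (simp add: free_comp_basis tree_rot_graft)
    then show ?case by (simp add: fc_simps fr_simps)
  qed (auto simp: fc_simps fr_simps free.scale_right_distrib free.scale_right_diff_distrib)
qed (auto simp: fc_simps fr_simps free.scale_right_distrib free.scale_right_diff_distrib)

lemma free_rot_comp_1:
  assumes "y \<in> free_space n"
  shows "free_rot (free_comp 1 x y) = - free_comp n (free_rot y) (free_rot x)"
  using assms
proof (induction y rule: free_space_induct)
  case (basis c s)
  show ?case
  proof (induction x rule: free_induct)
    case (basis d t)
    have "free_rot (free_comp 1 (basis t) (basis s)) = - free_comp n (free_rot (basis s)) (free_rot (basis t))"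
      using \<open>size1 s = n\<close> by (simp add: free_comp_basis tree_rot_graft_1[simplified])
    then show ?case by (simp add: fc_simps fr_simps)
  qed (auto simp: fc_simps fr_simps free.scale_right_distrib free.scale_right_diff_distrib)
qed (auto simp: fc_simps fr_simps free.scale_right_distrib free.scale_right_diff_distrib)

lemma corolla_rot: "tree_rot \<langle>\<langle>\<rangle>, x, \<langle>\<rangle>\<rangle> = gen_rot x"
proof -
  have "free_comp 1 (gen_rot x) (basis \<langle>\<rangle>) = gen_rot x"
    by (rule free_comp_unit_right[OF gen_rot_closed]) auto
  then show ?thesis
    by (simp add: fc_simps free_comp_unit_left[simplified])
qed

lemma free_rot_pow_comp:
  assumes "x \<in> free_space m" "y \<in> free_space n" "1 \<le> i" "i \<le> m" "1 \<le> n"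
    and x: "(free_rot ^^ (m + 1)) x = x" and y: "(free_rot ^^ (n + 1)) y = y"
  shows "(free_rot ^^ (m + n)) (free_comp i x y) = free_comp i x y"
proof -
  have cl: "(free_rot ^^ k) z \<in> free_space j" if "z \<in> free_space j" for j k z
    using that by (induction k) (auto simp: free_rot_closed)
  have A: "(free_rot ^^ k) (free_comp j z w) = free_comp (j - k) ((free_rot ^^ k) z) w"
    if "z \<in> free_space l" "k < j" "j \<le> l" for j k l z w
    using that(2)
  proof (induction k)
    case (Suc k)
    then show ?case using free_rot_comp[OF cl[OF that(1)], of "j - k" k w] that by simp
  qed simp
  have B: "(free_rot ^^ Suc l) (free_comp (Suc l) z w) = - free_comp k (free_rot w) ((free_rot ^^ Suc l) z)"
    if "z \<in> free_space j" "w \<in> free_space k" "Suc l \<le> j" for j k l z w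
    using A[OF that(1), of l "Suc l" w] that free_rot_comp_1[OF that(2)] by simp
  obtain a where a: "i = Suc a" using assms by (cases i) auto
  obtain b where b: "n = Suc b" using assms by (cases n) auto
  obtain d where d: "m = i + d" using assms le_Suc_ex by blast
  have neg: "(free_rot ^^ k) (- z) = - (free_rot ^^ k) z" for k z
    by (induction k) (simp_all add: fr_simps)
  have "m + n = d + (n + i)" using d by simp
  then have "(free_rot ^^ (m + n)) (free_comp i x y) =
      (free_rot ^^ d) ((free_rot ^^ n) ((free_rot ^^ i) (free_comp i x y)))"
    by (simp only: funpow_add comp_apply)
  also have "(free_rot ^^ i) (free_comp i x y) = - free_comp n (free_rot y) ((free_rot ^^ i) x)"
    using B[OF assms(1,2), of a] a assms by simp
  also have "(free_rot ^^ n) \<dots> = free_comp m (free_rot ((free_rot ^^ i) x)) ((free_rot ^^ n) (free_rot y))"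
    unfolding neg using B[OF free_rot_closed[OF assms(2)] cl[OF assms(1)], of b i] b by simp
  also have "(free_rot ^^ n) (free_rot y) = y"
    using y by (simp add: funpow_swap1)
  also have "(free_rot ^^ d) (free_comp m (free_rot ((free_rot ^^ i) x)) y) =
      free_comp (m - d) ((free_rot ^^ d) (free_rot ((free_rot ^^ i) x))) y"
    using assms d by (intro A[of _ m]) (auto intro: free_rot_closed cl)
  also have "(free_rot ^^ d) (free_rot ((free_rot ^^ i) x)) = (free_rot ^^ (d + (1 + i))) x"
    by (simp add: funpow_add funpow_swap1)
  also have "d + (1 + i) = m + 1" using d by simp
  also note x
  finally show ?thesis using d by simp
qed

lemma free_rot_order: 
  assumes "x \<in> free_space n"
  shows "(free_rot ^^ (n + 1)) x = x"
proof -
  have "(free_rot ^^ 3) (corolla y) = corolla y" for y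
    by (cases y) (simp_all add: numeral_3_eq_3 fr_simps corolla_rot del: tree_rot.simps)
  then have gen: "(free_rot ^^ (2 + 1)) (corolla y) = corolla y" for y by simp
  have c2: "corolla y \<in> free_space 2" for y by (simp add: free_space_def)
  have t: "(free_rot ^^ (size1 t + 1)) (basis t) = basis t" for t
  proof (induction t)
    case Leaf
    show ?case by (simp add: fr_simps)
  next
    case (Node l y r)
    have 1: "(free_rot ^^ (2 + size1 r)) (free_comp 2 (corolla y) (basis r)) = free_comp 2 (corolla y) (basis r)"
      by (rule free_rot_pow_comp[OF c2 basis_in_space _ _ _ gen Node.IH(2)]) auto
    have 2: "free_comp 2 (corolla y) (basis r) \<in> free_space (1 + size1 r)"
      using free_comp_closed[OF c2 basis_in_space, of 2 y r] by simp
    have "(free_rot ^^ (1 + size1 r + size1 l)) (free_comp 1 (free_comp 2 (corolla y) (basis r)) (basis l)) =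
        free_comp 1 (free_comp 2 (corolla y) (basis r)) (basis l)"
      by (rule free_rot_pow_comp[OF 2 basis_in_space _ _ _ _ Node.IH(1)]) (use 1 in \<open>auto\<close>)
    then show ?case by (simp add: free_comp_basis add_ac)
  qed
  have pow: "(free_rot ^^ k) (x + y) = (free_rot ^^ k) x + (free_rot ^^ k) y" 
    "(free_rot ^^ k) (free_scale c x) = free_scale c ((free_rot ^^ k) x)" "(free_rot ^^ k) 0 = 0" for k x y c
    by (induction k) (simp_all add: fr_simps)
  from assms show ?thesis
  proof (induction x rule: free_space_induct)
    case (basis c t)
    then show ?case using t[of t] by (simp only: pow)
  qed (simp_all only: pow)
qed

subsection \<open>The dendriform ideal is stable under rotation\<close>

lemma dend_ideal_0: "0 \<in> dend_ideal"
  using dend_ideal.scale[OF dend_ideal.rel1, of 0] by simp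

lemma dend_ideal_neg: "x \<in> dend_ideal \<Longrightarrow> - x \<in> dend_ideal"
  using dend_ideal.scale[of x "- 1"] by simp

lemma dend_ideal_diff: "x \<in> dend_ideal \<Longrightarrow> y \<in> dend_ideal \<Longrightarrow> x - y \<in> dend_ideal"
  using dend_ideal.add[OF _ dend_ideal_neg, of x y] by simp

lemma dend_ideal_sum: "(\<And>a. a \<in> A \<Longrightarrow> f a \<in> dend_ideal) \<Longrightarrow> sum f A \<in> dend_ideal"
  by (induction A rule: infinite_finite_induct) (auto simp: dend_ideal_0 dend_ideal.add)

definition free_proj :: "nat \<Rightarrow> free \<Rightarrow> free"
  where "free_proj n = lin_ext (\<lambda>t. if size1 t = n then basis t else 0)"

lemmas free_proj_simps = 
  free2.linear_add[OF linear_lin_ext, of "\<lambda>t. if size1 t = n then basis t else 0" for n, folded free_proj_def]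
  free2.linear_scale[OF linear_lin_ext, of "\<lambda>t. if size1 t = n then basis t else 0" for n, folded free_proj_def]
  free2.linear_0[OF linear_lin_ext, of "\<lambda>t. if size1 t = n then basis t else 0" for n, folded free_proj_def]

lemma free_proj_basis: "free_proj n (basis t) = (if size1 t = n then basis t else 0)"
  by (simp add: free_proj_def)

lemma free_proj_in_space: "free_proj n x \<in> free_space n"
proof (induction x rule: free_induct)
  case (basis c t)
  show ?case using basis_in_space[of t] by (auto simp: free_proj_simps free_proj_basis fs_closed)
qed (simp_all add: free_proj_simps fs_closed)

lemma free_proj_space: "x \<in> free_space m \<Longrightarrow> free_proj n x = (if m = n then x else 0)"
  by (induction x rule: free_space_induct) (auto simp: free_proj_simps free_proj_basis)

lemma free_rot_ideal_proj:
  assumes "x \<in> dend_ideal"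
  shows "free_proj n x \<in> dend_ideal \<and> free_rot (free_proj n x) \<in> dend_ideal"
  using assms
proof (induction arbitrary: n)
  have c2: "corolla y \<in> free_space 2" for y by (simp add: free_space_def)
  have rot: "free_rot free_L = free_R" "free_rot free_R = - (free_L + free_R)"
    by (simp_all add: corolla_rot del: tree_rot.simps)
  have rc: "free_rot (free_comp 1 x y) = - free_comp 2 (free_rot y) (free_rot x)"
     "free_rot (free_comp 2 x y) = free_comp 1 (free_rot x) y"
    if "x \<in> free_space 2" "y \<in> free_space 2" for x y
    using free_rot_comp_1[OF that(2)] free_rot_comp[OF that(1), of 2] by auto
  have cl: "free_comp i x y \<in> free_space 3" if "x \<in> free_space 2" "y \<in> free_space 2" for i x y
    using free_comp_closed[OF that] by simp
  note cls = c2 fs_closed cl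
  have hom: "free_proj n x \<in> dend_ideal \<and> free_rot (free_proj n x) \<in> dend_ideal" 
    if "x \<in> free_space 3" "x \<in> dend_ideal" "free_rot x \<in> dend_ideal" for x n
    using that by (simp add: free_proj_space fr_simps dend_ideal_0)
  {
    case rel1
    have "free_rot (free_comp 1 free_L (free_L + free_R) - free_comp 2 free_L free_L) =
        - (free_comp 1 free_R free_L - free_comp 2 free_L free_R)"
      by (simp add: fc_simps fr_simps rc cls corolla_rot algebra_simps del: tree_rot.simps One_nat_def)
    then show ?case
      by (intro hom) (auto intro!: cls dend_ideal.rel1 dend_ideal_neg[OF dend_ideal.rel2] simp del: minus_diff_eq One_nat_def)
  next
    case rel2
    have "free_rot (free_comp 1 free_R free_L - free_comp 2 free_L free_R) =
        - (free_comp 1 free_R free_R - free_comp 2 free_R (free_L + free_R))"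
      by (simp add: fc_simps fr_simps rc cls corolla_rot algebra_simps del: tree_rot.simps One_nat_def)
    then show ?case
      by (intro hom) (auto intro!: cls dend_ideal.rel2 dend_ideal_neg[OF dend_ideal.rel3] simp del: minus_diff_eq One_nat_def)
  next
    case rel3
    have "free_rot (free_comp 1 free_R free_R - free_comp 2 free_R (free_L + free_R)) =
        (free_comp 1 free_L (free_L + free_R) - free_comp 2 free_L free_L) +
        (free_comp 1 free_R free_L - free_comp 2 free_L free_R) +
        (free_comp 1 free_R free_R - free_comp 2 free_R (free_L + free_R))"
      by (simp add: fc_simps fr_simps rc cls corolla_rot algebra_simps del: tree_rot.simps One_nat_def)
    then show ?case
      by (intro hom) (auto intro!: cls dend_ideal.rel3 
          dend_ideal.add[OF dend_ideal.add[OF dend_ideal.rel1 dend_ideal.rel2] dend_ideal.rel3] simp del: One_nat_def)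
  }
next
  case (add x y)
  then show ?case by (auto simp: free_proj_simps fr_simps intro: dend_ideal.add)
next
  case (scale x c)
  then show ?case by (auto simp: free_proj_simps fr_simps intro: dend_ideal.scale)
next
  case (comp_left x i y)
  show ?case
  proof (induction y rule: free_induct)
    case zero
    then show ?case by (simp add: fc_simps free_proj_simps fr_simps dend_ideal_0)
  next
    case (add y z)
    then show ?case by (auto simp: fc_simps free_proj_simps fr_simps intro: dend_ideal.add)
  next
    case (basis c s)
    let ?a = "n + 1 - size1 s"
    let ?x = "free_proj ?a x"
    have "free_proj n (free_comp i x (basis s)) = free_comp i ?x (basis s)"
    proof (induction x rule: free_induct)
      case (basis d t)
      have "free_proj n (free_comp i (basis t) (basis s)) = free_comp i (free_proj ?a (basis t)) (basis s)"
        using size1_graft[of i t s] size1_pos(1)[of s] size1_pos(1)[of t] 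
        by (auto simp: free_comp_basis free_proj_basis free_proj_simps fc_simps)
      then show ?case by (simp add: fc_simps free_proj_simps)
    qed (simp_all add: fc_simps free_proj_simps)
    moreover have "free_rot (free_comp i ?x (basis s)) \<in> dend_ideal"
    proof -
      have sp: "?x \<in> free_space ?a" by (rule free_proj_in_space)
      have I: "free_rot ?x \<in> dend_ideal" using comp_left.IH by blast
      consider "i = 1" | "2 \<le> i" "i \<le> ?a" | "i = 0 \<or> ?a < i" by linarith
      then show ?thesis
      proof cases
        case 1
        then show ?thesis using free_rot_comp_1[OF basis_in_space, of ?x s] I
          by (simp add: dend_ideal_neg dend_ideal.comp_right)
      next
        case 2
        then show ?thesis using free_rot_comp[OF sp, of i] I by (simp add: dend_ideal.comp_left)
      next
        case 3
        from sp have "free_comp i ?x (basis s) = 0"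
          by (induction rule: free_space_induct) (use 3 in \<open>auto simp: fc_simps free_comp_basis\<close>)
        then show ?thesis by (simp add: fr_simps dend_ideal_0)
      qed
    qed
    ultimately show ?case using comp_left.IH[of ?a]
      by (auto simp: fc_simps free_proj_simps fr_simps intro!: dend_ideal.scale dend_ideal.comp_left)
  qed
next
  case (comp_right x i y)
  show ?case
  proof (induction y rule: free_induct)
    case zero
    then show ?case by (simp add: fc_simps free_proj_simps fr_simps dend_ideal_0)
  next
    case (add y z)
    then show ?case by (auto simp: fc_simps free_proj_simps fr_simps intro: dend_ideal.add)
  next
    case (basis c s)
    let ?a = "n + 1 - size1 s"
    let ?x = "free_proj ?a x"
    have "free_proj n (free_comp i (basis s) x) = free_comp i (basis s) ?x"
    proof (induction x rule: free_induct)
      case (basis d t)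
      have "free_proj n (free_comp i (basis s) (basis t)) = free_comp i (basis s) (free_proj ?a (basis t))"
        using size1_graft[of i s t] size1_pos(1)[of s] size1_pos(1)[of t] 
        by (auto simp: free_comp_basis free_proj_basis free_proj_simps fc_simps)
      then show ?case by (simp add: fc_simps free_proj_simps)
    qed (simp_all add: fc_simps free_proj_simps)
    moreover have "free_rot (free_comp i (basis s) ?x) \<in> dend_ideal"
    proof -
      have sp: "?x \<in> free_space ?a" by (rule free_proj_in_space)
      have I: "?x \<in> dend_ideal" "free_rot ?x \<in> dend_ideal" using comp_right.IH by blast+
      consider "i = 1" | "2 \<le> i" "i \<le> size1 s" | "i = 0 \<or> size1 s < i" by linarith
      then show ?thesis
      proof cases
        case 1
        then show ?thesis using free_rot_comp_1[OF sp, of "basis s"] I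
          by (simp add: dend_ideal_neg dend_ideal.comp_left)
      next
        case 2
        then show ?thesis using free_rot_comp[OF basis_in_space, of i s] I by (simp add: dend_ideal.comp_right)
      next
        case 3
        from sp have "free_comp i (basis s) ?x = 0"
          by (induction rule: free_space_induct) (use 3 in \<open>auto simp: fc_simps free_comp_basis\<close>)
        then show ?thesis by (simp add: fr_simps dend_ideal_0)
      qed
    qed
    ultimately show ?case using comp_right.IH[of ?a]
      by (auto simp: fc_simps free_proj_simps fr_simps intro!: dend_ideal.scale dend_ideal.comp_right)
  qed
qed

lemma free_rot_ideal:
  assumes "x \<in> dend_ideal"
  shows "free_rot x \<in> dend_ideal"
proof -
  let ?A = "size1 ` Poly_Mapping.keys x"
  have "(\<Sum>n\<in>?A. free_proj n x) = (\<Sum>n\<in>?A. \<Sum>t\<in>Poly_Mapping.keys x. if size1 t = n then free_scale (Poly_Mapping.lookup x t) (basis t) else 0)"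
    unfolding free_proj_def lin_ext_def by (intro sum.cong refl) (auto simp: if_distrib cong: if_cong)
  also have "\<dots> = (\<Sum>t\<in>Poly_Mapping.keys x. \<Sum>n\<in>?A. if size1 t = n then free_scale (Poly_Mapping.lookup x t) (basis t) else 0)"
    by (rule sum.swap)
  also have "\<dots> = x"
    by (subst (5) free_expand) (simp add: sum.delta)
  finally have "free_rot x = (\<Sum>n\<in>?A. free_rot (free_proj n x))"
    by (metis free2.linear_sum[OF linear_free_rot])
  then show ?thesis using free_rot_ideal_proj[OF assms] by (simp add: dend_ideal_sum)
qed


subsection \<open>The quotient\<close>

lemma equivp_dend_rel: "equivp dend_rel"
proof (rule equivpI)
  show "reflp dend_rel" by (simp add: reflp_def dend_rel_def dend_ideal_0)
  show "symp dend_rel"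
    using dend_ideal_neg by (fastforce simp: symp_def dend_rel_def)
  show "transp dend_rel"
    using dend_ideal.add by (fastforce simp: transp_def dend_rel_def)
qed

quotient_type dend = free / dend_rel
  by (rule equivp_dend_rel)

instantiation dend :: ab_group_add
begin

lift_definition zero_dend :: dend is "0 :: free" .

lift_definition plus_dend :: "dend \<Rightarrow> dend \<Rightarrow> dend" is "(+)"
  unfolding dend_rel_def using dend_ideal.add by (fastforce simp: algebra_simps)

lift_definition uminus_dend :: "dend \<Rightarrow> dend" is "uminus"
  unfolding dend_rel_def using dend_ideal_neg by (fastforce simp: algebra_simps)

lift_definition minus_dend :: "dend \<Rightarrow> dend \<Rightarrow> dend" is "(-)"
  unfolding dend_rel_def using dend_ideal_diff by (fastforce simp: algebra_simps)

instance
  by standard (transfer; simp add: algebra_simps dend_rel_def dend_ideal_0)+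

end

lift_definition dend_scale :: "rat \<Rightarrow> dend \<Rightarrow> dend" is free_scale
  unfolding dend_rel_def by (metis dend_ideal.scale free.scale_right_diff_distrib)

lift_definition dend_comp :: "nat \<Rightarrow> dend \<Rightarrow> dend \<Rightarrow> dend" is free_comp
proof -
  fix i and x x' y y' :: free
  assume "dend_rel x x'" "dend_rel y y'"
  then have "free_comp i (x - x') y + free_comp i x' (y - y') \<in> dend_ideal"
    by (auto simp: dend_rel_def intro: dend_ideal.intros)
  then show "dend_rel (free_comp i x y) (free_comp i x' y')"
    by (simp add: dend_rel_def fc_simps)
qed

lift_definition dend_rot :: "dend \<Rightarrow> dend" is free_rot
  unfolding dend_rel_def by (metis free_rot_ideal free2.linear_diff[OF linear_free_rot])

lift_definition dend_L :: dend is free_L .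
lift_definition dend_R :: dend is free_R .
lift_definition dend_unit :: dend is "basis \<langle>\<rangle>" .

definition dend_space :: "nat \<Rightarrow> dend set"
  where "dend_space n = abs_dend ` free_space n"

definition Dend :: "dend anticyclic"
  where "Dend = \<lparr>space = dend_space, scale = dend_scale, unit = dend_unit,
    comp = (\<lambda>m n. dend_comp), rot = (\<lambda>n. dend_rot)\<rparr>"

lemma Dend_relations:
  "dend_comp 1 dend_L (dend_L + dend_R) = dend_comp 2 dend_L dend_L"
  "dend_comp 1 dend_R dend_L = dend_comp 2 dend_L dend_R"
  "dend_comp 1 dend_R dend_R = dend_comp 2 dend_R (dend_L + dend_R)"
  by (transfer; simp only: dend_rel_def dend_ideal.rel1 dend_ideal.rel2 dend_ideal.rel3)+

lemma Dend_rot_generators: "dend_rot dend_L = dend_R" "dend_rot dend_R = - (dend_L + dend_R)"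
  by (transfer; simp add: corolla_rot dend_rel_def dend_ideal_0 del: tree_rot.simps)+

lemma free_to_dend: "x = y \<Longrightarrow> dend_rel x y"
  by (simp add: dend_rel_def dend_ideal_0)

lemma dend_spaceE:
  assumes "f \<in> dend_space n" obtains x where "x \<in> free_space n" "f = abs_dend x"
  using assms by (auto simp: dend_space_def)

lemmas abs_simps = plus_dend.abs_eq dend_scale.abs_eq dend_comp.abs_eq dend_rot.abs_eq
  uminus_dend.abs_eq dend_unit.abs_eq

lemma dend_spaceI: "x \<in> free_space n \<Longrightarrow> abs_dend x \<in> dend_space n"
  by (simp add: dend_space_def)

lemma anticyclic_operad_Dend: "anticyclic_operad Dend"
proof -
  interpret vector_space dend_scale
    by standard (transfer; rule free_to_dend; simp add: free.scale_left_distrib free.scale_right_distrib)+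
  have pow: "(dend_rot ^^ n) (abs_dend x) = abs_dend ((free_rot ^^ n) x)" for n x
    by (induction n) (simp_all add: abs_simps)
  have vs: "vector_space dend_scale" ..
  have sub: "subspace (dend_space n)" for n
    unfolding subspace_def 
    by (auto elim!: dend_spaceE simp: abs_simps zero_dend.abs_eq fs_closed intro!: dend_spaceI)
  have seq: "free_comp (i + j - 1) (free_comp i x y) z = free_comp i x (free_comp j y z)"
    if "x \<in> free_space l" "y \<in> free_space m" "1 \<le> i" "i \<le> l" "1 \<le> j" "j \<le> m" for i j l m x y z
    using free_sequential[OF that, of z] that by simp
  have par: "free_comp (k + m - 1) (free_comp i x y) z = free_comp i (free_comp k x z) y"
    if "x \<in> free_space l" "y \<in> free_space m" "z \<in> free_space n" "1 \<le> i" "i < k" "k \<le> l"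
    for i k l m n x y z
    using free_parallel[OF that] that by simp
  have unit: "basis \<langle>\<rangle> \<in> free_space 1"
    using basis_in_space[of "\<langle>\<rangle>"] by simp
  show "anticyclic_operad Dend"
    unfolding anticyclic_operad_def ns_operad_def anticyclic_operad_axioms_def ns_operad_axioms_def
  proof (intro conjI allI impI; (elim dend_spaceE)?; simp only: Dend_def operad.select_convs anticyclic.select_convs vs sub; (elim dend_spaceE)?; hypsubst?; simp only: abs_simps pow)
  qed (auto simp: fc_simps fr_simps intro!: dend_spaceI free_comp_closed free_rot_closed
     simp: free_comp_unit_left free_comp_unit_right seq par unit free_rot_order free_rot_comp free_rot_comp_1
     simp del: One_nat_def funpow.simps)
qed


section \<open>Mould is an anticyclic operad\<close>

lemma Fract_1_simps:
  "Fract (p :: mpoly) 1 + Fract q 1 = Fract (p + q) 1" "Fract (p :: mpoly) 1 * Fract q 1 = Fract (p * q) 1"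
  "Fract (p :: mpoly) 1 = Fract q 1 \<longleftrightarrow> p = q"
  by (simp_all add: eq_fract)

lemma const_simps [simp]: "const 0 = 0" "const 1 = 1"
  by (simp_all add: const_def fract_collapse)

lemma const_add: "const (a + b) = const a + const b"
  by (simp add: const_def Fract_1_simps single_add)

lemma const_mult: "const (a * b) = const a * const b"
  by (simp add: const_def mult_single)

lemma const_uminus: "const (- a) = - const a"
  using const_add[of a "- a"] by (simp add: minus_unique)

lemma const_inverse: "c \<noteq> 0 \<Longrightarrow> const c * const (inverse c) = 1"
  by (simp flip: const_mult)

definition mpoly_mono :: "(nat \<Rightarrow> ratfun) \<Rightarrow> (nat \<Rightarrow>\<^sub>0 nat) \<Rightarrow> ratfun"
  where "mpoly_mono \<sigma> m = (\<Prod>k\<in>Poly_Mapping.keys m. \<sigma> k ^ Poly_Mapping.lookup m k)"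

lemma mpoly_mono_superset:
  assumes "finite A" "Poly_Mapping.keys m \<subseteq> A"
  shows "mpoly_mono \<sigma> m = (\<Prod>k\<in>A. \<sigma> k ^ Poly_Mapping.lookup m k)"
  unfolding mpoly_mono_def
  by (rule prod.mono_neutral_left) (use assms in \<open>auto simp: in_keys_iff\<close>)

lemma mpoly_mono_add: "mpoly_mono \<sigma> (m + m') = mpoly_mono \<sigma> m * mpoly_mono \<sigma> m'"
  using keys_add[of m m']
  by (simp add: mpoly_mono_superset[where A = "Poly_Mapping.keys m \<union> Poly_Mapping.keys m'"]
      lookup_add power_add prod.distrib)

lemma mpoly_mono_0 [simp]: "mpoly_mono \<sigma> 0 = 1"
  by (simp add: mpoly_mono_def)

lemma eval_altdef: "eval_mpoly \<sigma> p =
   (\<Sum>m\<in>Poly_Mapping.keys p. const (Poly_Mapping.lookup p m) * mpoly_mono \<sigma> m)"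
  by (simp add: eval_mpoly_def mpoly_mono_def)

lemma eval_superset:
  assumes "finite A" "Poly_Mapping.keys p \<subseteq> A"
  shows "eval_mpoly \<sigma> p = (\<Sum>m\<in>A. const (Poly_Mapping.lookup p m) * mpoly_mono \<sigma> m)"
  unfolding eval_altdef
  by (rule sum.mono_neutral_left) (use assms in \<open>auto simp: in_keys_iff\<close>)

lemma eval_add: "eval_mpoly \<sigma> (p + q) = eval_mpoly \<sigma> p + eval_mpoly \<sigma> q"
  using keys_add[of p q]
  by (simp add: eval_superset[where A = "Poly_Mapping.keys p \<union> Poly_Mapping.keys q"]
      lookup_add const_add sum.distrib distrib_right)

lemma eval_0 [simp]: "eval_mpoly \<sigma> 0 = 0"
  by (simp add: eval_altdef)

lemma eval_single [simp]: "eval_mpoly \<sigma> (Poly_Mapping.single m c) = const c * mpoly_mono \<sigma> m"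
  by (simp add: eval_altdef lookup_single)

lemma mpoly_induct [case_names zero add single]:
  fixes p :: mpoly
  assumes "P 0" "\<And>p q. P p \<Longrightarrow> P q \<Longrightarrow> P (p + q)" "\<And>m c. P (Poly_Mapping.single m c)"
  shows "P p"
proof -
  have "p = (\<Sum>m\<in>Poly_Mapping.keys p. Poly_Mapping.single m (Poly_Mapping.lookup p m))"
    by (rule poly_mapping_eqI)
      (simp add: lookup_sum lookup_single when_def in_keys_iff if_distrib cong: if_cong)
  moreover have "finite A \<Longrightarrow> P (\<Sum>m\<in>A. Poly_Mapping.single m (f m))" for A f
    by (induction A rule: finite_induct) (auto simp: assms)
  ultimately show ?thesis by (metis finite_keys)
qed

lemma eval_mult: "eval_mpoly \<sigma> (p * q) = eval_mpoly \<sigma> p * eval_mpoly \<sigma> q"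
proof (induction p rule: mpoly_induct)
  case (single m c)
  show ?case
    by (induction q rule: mpoly_induct)
      (auto simp: eval_add distrib_left mult_single const_mult mpoly_mono_add)
qed (simp_all add: eval_add distrib_right)

lemma eval_1 [simp]: "eval_mpoly \<sigma> 1 = 1"
  using eval_single[of \<sigma> 0 1] by (simp del: eval_single)

lemma subst_eq:
  assumes "f = Fract p q" "eval_mpoly \<sigma> q \<noteq> 0"
  shows "subst \<sigma> f = eval_mpoly \<sigma> p / eval_mpoly \<sigma> q"
  unfolding subst_def
proof (rule the_equality)
  show "\<exists>p' q'. f = Fract p' q' \<and> eval_mpoly \<sigma> q' \<noteq> 0 \<and>
     eval_mpoly \<sigma> p / eval_mpoly \<sigma> q = eval_mpoly \<sigma> p' / eval_mpoly \<sigma> q'"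
    using assms by blast
next
  fix h
  assume "\<exists>p q. f = Fract p q \<and> eval_mpoly \<sigma> q \<noteq> 0 \<and> h = eval_mpoly \<sigma> p / eval_mpoly \<sigma> q"
  then obtain p' q' where *: "f = Fract p' q'" "eval_mpoly \<sigma> q' \<noteq> 0" "h = eval_mpoly \<sigma> p' / eval_mpoly \<sigma> q'"
    by blast
  have "q \<noteq> 0" "q' \<noteq> 0" using assms * by auto
  with assms * have "p * q' = p' * q" by (simp add: eq_fract)
  then have "eval_mpoly \<sigma> p * eval_mpoly \<sigma> q' = eval_mpoly \<sigma> p' * eval_mpoly \<sigma> q"
    by (metis eval_mult)
  with assms * show "h = eval_mpoly \<sigma> p / eval_mpoly \<sigma> q" by (simp add: frac_eq_eq)
qed

lemma subst_poly: "subst \<sigma> (Fract p 1) = eval_mpoly \<sigma> p"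
  by (subst subst_eq[OF refl]) auto

text \<open>For such \<open>\<sigma>\<close> (algebraically independent) substitution is a field homomorphism.\<close>

definition good_subst :: "(nat \<Rightarrow> ratfun) \<Rightarrow> bool"
  where "good_subst \<sigma> \<longleftrightarrow> (\<forall>p. eval_mpoly \<sigma> p = 0 \<longrightarrow> p = 0)"

lemma good_eq_0_iff: "good_subst \<sigma> \<Longrightarrow> eval_mpoly \<sigma> p = 0 \<longleftrightarrow> p = 0"
  by (auto simp: good_subst_def)

lemma subst_Fract: "good_subst \<sigma> \<Longrightarrow> q \<noteq> 0 \<Longrightarrow> subst \<sigma> (Fract p q) = eval_mpoly \<sigma> p / eval_mpoly \<sigma> q"
  by (rule subst_eq) (auto simp: good_subst_def)

lemma subst_add: "good_subst \<sigma> \<Longrightarrow> subst \<sigma> (f + g) = subst \<sigma> f + subst \<sigma> g"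
  by (cases f; cases g) (auto simp: subst_Fract eval_add eval_mult add_frac_eq good_eq_0_iff)

lemma subst_mult: "good_subst \<sigma> \<Longrightarrow> subst \<sigma> (f * g) = subst \<sigma> f * subst \<sigma> g"
  by (cases f; cases g) (auto simp: subst_Fract eval_mult)

lemma subst_const [simp]: "subst \<sigma> (const c) = const c"
  by (simp add: const_def subst_poly)

lemma subst_01 [simp]: "subst \<sigma> 0 = 0" "subst \<sigma> 1 = 1"
  using subst_const[of \<sigma> 0] subst_const[of \<sigma> 1] by (simp_all del: subst_const)

lemma subst_u [simp]: "subst \<sigma> (u k) = \<sigma> k"
  by (simp add: u_def subst_poly mpoly_mono_def)

lemma subst_uminus: "good_subst \<sigma> \<Longrightarrow> subst \<sigma> (- f) = - subst \<sigma> f"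
  using subst_add[of \<sigma> f "- f"] by (simp add: minus_unique)

lemma subst_inverse: "good_subst \<sigma> \<Longrightarrow> subst \<sigma> (inverse f) = inverse (subst \<sigma> f)"
proof (cases "f = 0")
  case False
  assume "good_subst \<sigma>"
  from subst_mult[OF this, of f "inverse f"] False show ?thesis
    by (simp add: inverse_unique)
qed simp

lemma subst_divide: "good_subst \<sigma> \<Longrightarrow> subst \<sigma> (f / g) = subst \<sigma> f / subst \<sigma> g"
  by (simp add: divide_inverse subst_mult subst_inverse)

lemma subst_eq_0_iff: "good_subst \<sigma> \<Longrightarrow> subst \<sigma> f = 0 \<longleftrightarrow> f = 0"
  using subst_mult[of \<sigma> f "inverse f"] by (cases "f = 0") auto

lemma subst_sum: "good_subst \<sigma> \<Longrightarrow> subst \<sigma> (sum f A) = (\<Sum>a\<in>A. subst \<sigma> (f a))"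
  by (induction A rule: infinite_finite_induct) (auto simp: subst_add)

lemma subst_power: "good_subst \<sigma> \<Longrightarrow> subst \<sigma> (f ^ n) = subst \<sigma> f ^ n"
  by (induction n) (auto simp: subst_mult)

lemma subst_prod: "good_subst \<sigma> \<Longrightarrow> subst \<sigma> (prod f A) = (\<Prod>a\<in>A. subst \<sigma> (f a))"
  by (induction A rule: infinite_finite_induct) (auto simp: subst_mult)

lemma subst_usum: "good_subst \<sigma> \<Longrightarrow> subst \<sigma> (usum i j) = (\<Sum>k=i..j. \<sigma> k)"
  by (simp add: usum_def subst_sum)

lemma subst_eval: "good_subst \<sigma> \<Longrightarrow> subst \<sigma> (eval_mpoly \<rho> p) = eval_mpoly (\<lambda>k. subst \<sigma> (\<rho> k)) p"
  by (simp add: eval_mpoly_def subst_sum subst_mult subst_prod subst_power)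

lemma eval_u: "eval_mpoly u p = Fract p 1"
proof (induction p rule: mpoly_induct)
  case (single m c)
  have pw: "u k ^ n = Fract (Poly_Mapping.single (Poly_Mapping.single k n) 1) 1" for k n
    by (induction n) (auto simp: u_def mult_single fract_collapse simp flip: single_add)
  have pr: "finite A \<Longrightarrow> (\<Prod>k\<in>A. Fract (Poly_Mapping.single (f k) 1) 1) =
      Fract (Poly_Mapping.single (\<Sum>k\<in>A. f k) 1 :: mpoly) 1" for A and f :: "nat \<Rightarrow> nat \<Rightarrow>\<^sub>0 nat"
    by (induction A rule: finite_induct) (auto simp: mult_single fract_collapse)
  have "(\<Sum>k\<in>Poly_Mapping.keys m. Poly_Mapping.single k (Poly_Mapping.lookup m k)) = m"
    by (rule poly_mapping_eqI)
      (simp add: lookup_sum lookup_single when_def in_keys_iff if_distrib cong: if_cong)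
  then have "mpoly_mono u m = Fract (Poly_Mapping.single m 1) 1"
    by (simp add: mpoly_mono_def pw pr)
  then show ?case by (simp add: const_def mult_single)
qed (simp_all add: eval_add fract_collapse Fract_1_simps)

lemma good_u: "good_subst u"
  by (auto simp: good_subst_def eval_u fract_expand Fract_1_simps eq_fract)

lemma subst_u_id: "subst u f = f"
  by (cases f) (simp add: subst_Fract good_u eval_u)

lemma good_compose: "good_subst \<sigma> \<Longrightarrow> good_subst \<rho> \<Longrightarrow> good_subst (\<lambda>k. subst \<sigma> (\<rho> k))"
  by (metis good_subst_def subst_eval subst_eq_0_iff)

lemma subst_subst:
  assumes "good_subst \<sigma>" "good_subst \<rho>"
  shows "subst \<sigma> (subst \<rho> f) = subst (\<lambda>k. subst \<sigma> (\<rho> k)) f"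
  by (cases f) (simp add: assms subst_Fract good_compose subst_divide subst_eval)


definition poly_set :: "ratfun set"
  where "poly_set = range (\<lambda>p. Fract p 1)"

lemma poly_set_closed [intro]:
  "f \<in> poly_set \<Longrightarrow> g \<in> poly_set \<Longrightarrow> f + g \<in> poly_set"
  "f \<in> poly_set \<Longrightarrow> g \<in> poly_set \<Longrightarrow> f * g \<in> poly_set"
  "f \<in> poly_set \<Longrightarrow> - f \<in> poly_set"
  "const c \<in> poly_set" "u k \<in> poly_set" "0 \<in> poly_set" "1 \<in> poly_set"
  by (auto simp: poly_set_def Fract_1_simps const_def u_def fract_expand)

lemma poly_set_sum: "(\<And>a. a \<in> A \<Longrightarrow> f a \<in> poly_set) \<Longrightarrow> sum f A \<in> poly_set"
  by (induction A rule: infinite_finite_induct) auto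

lemma subst_poly_hom:
  assumes "f \<in> poly_set" "g \<in> poly_set"
  shows "subst \<sigma> (f + g) = subst \<sigma> f + subst \<sigma> g" "subst \<sigma> (f * g) = subst \<sigma> f * subst \<sigma> g"
    "subst \<sigma> (- f) = - subst \<sigma> f"
proof -
  have *: "subst \<sigma> (f + g) = subst \<sigma> f + subst \<sigma> g" if "f \<in> poly_set" "g \<in> poly_set" for f g
    using that by (auto simp: poly_set_def Fract_1_simps subst_poly eval_add)
  show "subst \<sigma> (f + g) = subst \<sigma> f + subst \<sigma> g"
    using assms by (rule *)
  show "subst \<sigma> (f * g) = subst \<sigma> f * subst \<sigma> g"
    using assms by (auto simp: poly_set_def Fract_1_simps(2) subst_poly eval_mult simp del: mult_fract)
  show "subst \<sigma> (- f) = - subst \<sigma> f"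
    using *[OF assms(1) poly_set_closed(3)[OF assms(1)]] by (simp add: minus_unique)
qed

lemma subst_poly_sum:
  "(\<And>a. a \<in> A \<Longrightarrow> f a \<in> poly_set) \<Longrightarrow> subst \<sigma> (sum f A) = (\<Sum>a\<in>A. subst \<sigma> (f a))"
  by (induction A rule: infinite_finite_induct) (auto simp: subst_poly_hom poly_set_sum)

lemma usum_poly [intro]: "usum i j \<in> poly_set"
  by (auto simp: usum_def intro: poly_set_sum)

lemma subst_poly_usum: "subst \<sigma> (usum i j) = (\<Sum>k=i..j. \<sigma> k)"
  unfolding usum_def by (subst subst_poly_sum) auto

lemma goodI:
  assumes "\<And>k. \<sigma> k \<in> poly_set" "\<And>k. subst \<rho> (\<sigma> k) = u k"
  shows "good_subst \<sigma>"
proof -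
  have pw: "\<sigma> k ^ n \<in> poly_set \<and> subst \<rho> (\<sigma> k ^ n) = u k ^ n" for k n
    by (induction n) (auto simp: subst_poly_hom assms)
  have mo: "mpoly_mono \<sigma> m \<in> poly_set \<and> subst \<rho> (mpoly_mono \<sigma> m) = mpoly_mono u m" for m
  proof -
    have "finite A \<Longrightarrow> (\<Prod>k\<in>A. \<sigma> k ^ Poly_Mapping.lookup m k) \<in> poly_set \<and>
      subst \<rho> (\<Prod>k\<in>A. \<sigma> k ^ Poly_Mapping.lookup m k) = (\<Prod>k\<in>A. u k ^ Poly_Mapping.lookup m k)" for A
      by (induction A rule: finite_induct) (auto simp: pw subst_poly_hom)
    then show ?thesis by (simp add: mpoly_mono_def)
  qed
  have "eval_mpoly \<sigma> p \<in> poly_set \<and> subst \<rho> (eval_mpoly \<sigma> p) = eval_mpoly u p" for p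
    by (induction p rule: mpoly_induct) (auto simp: eval_add subst_poly_hom mo poly_set_closed)
  then show ?thesis
    unfolding good_subst_def by (metis good_subst_def good_u subst_01(1))
qed

subsection \<open>Rational functions in finitely many variables\<close>

lemma vars_0 [simp]: "vars 0 = {}" "vars 1 = {}"
  by (auto simp: vars_def)

lemma vars_add: "vars (p + q) \<subseteq> vars p \<union> vars q"
  using keys_add[of p q] by (auto simp: vars_def)

lemma vars_uminus: "vars (- p) = vars p"
  by (simp add: vars_def)

lemma vars_mult: "vars (p * q) \<subseteq> vars p \<union> vars q"
proof -
  have "k \<in> vars p \<union> vars q" if "m \<in> Poly_Mapping.keys (p * q)" "k \<in> Poly_Mapping.keys m" for k m
  proof -
    from that(1) keys_mult[of p q] obtain a b
      where *: "m = a + b" "a \<in> Poly_Mapping.keys p" "b \<in> Poly_Mapping.keys q" by auto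
    with that(2) keys_add[of a b] have "k \<in> Poly_Mapping.keys a \<or> k \<in> Poly_Mapping.keys b" by auto
    with * show ?thesis by (auto simp: vars_def)
  qed
  then show ?thesis unfolding vars_def[of "p * q"] by blast
qed

lemma mouldE:
  assumes "f \<in> mould_space n"
  obtains p q where "q \<noteq> 0" "f = Fract p q" "vars p \<subseteq> {1..n}" "vars q \<subseteq> {1..n}"
  using assms by (auto simp: mould_space_def)

lemma mouldI: "q \<noteq> 0 \<Longrightarrow> vars p \<subseteq> {1..n} \<Longrightarrow> vars q \<subseteq> {1..n} \<Longrightarrow> Fract p q \<in> mould_space n"
  by (auto simp: mould_space_def)

lemma mould_0 [intro]: "0 \<in> mould_space n" "1 \<in> mould_space n" "const c \<in> mould_space n"
  by (auto simp: fract_expand const_def vars_def intro!: mouldI split: if_splits)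

lemma mould_u [intro]: "1 \<le> k \<Longrightarrow> k \<le> n \<Longrightarrow> u k \<in> mould_space n"
  unfolding u_def by (rule mouldI) (auto simp: vars_def)

lemma mould_closed [intro]:
  assumes "f \<in> mould_space n"
  shows "g \<in> mould_space n \<Longrightarrow> f + g \<in> mould_space n" "g \<in> mould_space n \<Longrightarrow> f * g \<in> mould_space n"
    "- f \<in> mould_space n" "inverse f \<in> mould_space n"
proof -
  from assms obtain p q where f: "q \<noteq> 0" "f = Fract p q" "vars p \<subseteq> {1..n}" "vars q \<subseteq> {1..n}"
    by (rule mouldE)
  show "- f \<in> mould_space n"
    using f by (auto simp: vars_uminus intro!: mouldI)
  show "inverse f \<in> mould_space n"
    using f by (cases "p = 0") (auto simp: fract_collapse intro!: mouldI)
  assume "g \<in> mould_space n"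
  then obtain p' q' where g: "q' \<noteq> 0" "g = Fract p' q'" "vars p' \<subseteq> {1..n}" "vars q' \<subseteq> {1..n}"
    by (rule mouldE)
  note v = vars_mult[of p p'] vars_mult[of q q'] vars_mult[of p q'] vars_mult[of p' q]
     vars_add[of "p * q'" "p' * q"]
  have "Fract (p * q' + p' * q) (q * q') \<in> mould_space n"
    by (rule mouldI; (use f g in simp; fail | use v f g in blast))
  then show "f + g \<in> mould_space n" using f g by simp
  have "Fract (p * p') (q * q') \<in> mould_space n"
    by (rule mouldI; use v f g in force)
  then show "f * g \<in> mould_space n" using f g by simp
qed

lemma mould_divide [intro]: "f \<in> mould_space n \<Longrightarrow> g \<in> mould_space n \<Longrightarrow> f / g \<in> mould_space n"
  by (auto simp: divide_inverse)

lemma mould_sum [intro]: "(\<And>a. a \<in> A \<Longrightarrow> f a \<in> mould_space n) \<Longrightarrow> sum f A \<in> mould_space n"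
  by (induction A rule: infinite_finite_induct) auto

lemma mould_prod [intro]: "(\<And>a. a \<in> A \<Longrightarrow> f a \<in> mould_space n) \<Longrightarrow> prod f A \<in> mould_space n"
  by (induction A rule: infinite_finite_induct) auto

lemma mould_power [intro]: "f \<in> mould_space n \<Longrightarrow> f ^ k \<in> mould_space n"
  by (induction k) auto

lemma mould_usum [intro]: "1 \<le> i \<Longrightarrow> j \<le> n \<Longrightarrow> usum i j \<in> mould_space n"
  unfolding usum_def by (rule mould_sum) auto

lemma eval_cong: "(\<And>k. k \<in> vars p \<Longrightarrow> \<sigma> k = \<rho> k) \<Longrightarrow> eval_mpoly \<sigma> p = eval_mpoly \<rho> p"
proof -
  assume "\<And>k. k \<in> vars p \<Longrightarrow> \<sigma> k = \<rho> k"
  then have "\<sigma> k = \<rho> k" if "m \<in> Poly_Mapping.keys p" "k \<in> Poly_Mapping.keys m" for k m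
    using that unfolding vars_def by blast
  then show ?thesis unfolding eval_mpoly_def by (intro sum.cong refl) simp
qed

lemma subst_cong:
  assumes "good_subst \<sigma>" "good_subst \<rho>" "f \<in> mould_space n" "\<And>k. 1 \<le> k \<Longrightarrow> k \<le> n \<Longrightarrow> \<sigma> k = \<rho> k"
  shows "subst \<sigma> f = subst \<rho> f"
proof -
  from assms(3) obtain p q where f: "q \<noteq> 0" "f = Fract p q" "vars p \<subseteq> {1..n}" "vars q \<subseteq> {1..n}"
    by (rule mouldE)
  have "eval_mpoly \<sigma> p = eval_mpoly \<rho> p" "eval_mpoly \<sigma> q = eval_mpoly \<rho> q"
    by (rule eval_cong, use f assms(4) in force)+
  with f assms(1,2) show ?thesis by (simp add: subst_Fract)
qed

lemma subst_mould:
  assumes "good_subst \<sigma>" "f \<in> mould_space n" "\<And>k. 1 \<le> k \<Longrightarrow> k \<le> n \<Longrightarrow> \<sigma> k \<in> mould_space m"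
  shows "subst \<sigma> f \<in> mould_space m"
proof -
  have e: "eval_mpoly \<sigma> p \<in> mould_space m" if "vars p \<subseteq> {1..n}" for p
    unfolding eval_mpoly_def
    by (intro mould_sum mould_closed mould_prod mould_power assms mould_0)
      (use that in \<open>auto simp: vars_def\<close>)
  from assms(2) obtain p q where f: "q \<noteq> 0" "f = Fract p q" "vars p \<subseteq> {1..n}" "vars q \<subseteq> {1..n}"
    by (rule mouldE)
  then show ?thesis using assms(1) e by (auto simp: subst_Fract)
qed

definition csub :: "nat \<Rightarrow> nat \<Rightarrow> nat \<Rightarrow> ratfun"
  where "csub i n k = (if k < i then u k else if k = i then usum i (i + n - 1) else u (k + n - 1))"

definition rsub :: "nat \<Rightarrow> nat \<Rightarrow> ratfun"
  where "rsub n k = (if k = 1 then - usum 1 n else if 2 \<le> k \<and> k \<le> n then u (k - 1) else u k)"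

definition ssub :: "nat \<Rightarrow> nat \<Rightarrow> ratfun"
  where "ssub i k = u (k + i - 1)"

lemma mould_comp_altdef:
  "mould_comp m n i f g = usum i (i + n - 1) * subst (csub i n) f * subst (ssub i) g"
  unfolding mould_comp_def csub_def[abs_def] ssub_def[abs_def] ..

lemma mould_rot_altdef: "mould_rot n f = subst (rsub n) f"
  unfolding mould_rot_def rsub_def[abs_def] ..

lemma good_ssub: "1 \<le> i \<Longrightarrow> good_subst (ssub i)"
  by (rule goodI[where \<rho> = "\<lambda>k. u (k + 1 - i)"]) (auto simp: ssub_def)

lemma good_csub: 
  assumes "1 \<le> i" "1 \<le> n" shows "good_subst (csub i n)"
proof (rule goodI[where \<rho> = "\<lambda>k. if k \<le> i then u k else if k < i + n then 0 else u (k + 1 - n)"], goal_cases)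
  case (2 k)
  have "(\<Sum>k = i..i + n - 1. if k \<le> i then u k else if k < i + n then 0 else u (k + 1 - n)) = (\<Sum>k \<in> {i}. u k)"
    by (rule sum.mono_neutral_cong_right) (use assms in auto)
  then show ?case using assms by (auto simp: csub_def subst_poly_usum)
qed (auto simp: csub_def)

lemma good_rsub: 
  assumes "1 \<le> n" shows "good_subst (rsub n)"
proof (rule goodI[where \<rho> = "\<lambda>k. if 1 \<le> k \<and> k < n then u (k + 1) else if k = n then - usum 1 n else u k"], goal_cases)
  case (2 k)
  obtain m where n: "n = Suc m" using assms by (cases n) auto
  have "(\<Sum>k = 1..m. if 1 \<le> k \<and> k < n then u (k + 1) else if k = n then - usum 1 n else u k)
      = (\<Sum>k=1..m. u (Suc k))"
    by (rule sum.cong) (auto simp: n)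
  also have "\<dots> = usum 1 n - u 1"
    unfolding usum_def n One_nat_def sum.shift_bounds_cl_Suc_ivl[symmetric]
    by (subst (2) sum.atLeast_Suc_atMost) simp_all
  finally have "(\<Sum>k = 1..n. if 1 \<le> k \<and> k < n then u (k + 1) else if k = n then - usum 1 n else u k) = - u 1"
    by (simp add: n)
  then show ?case using assms by (auto simp: rsub_def subst_poly_usum subst_poly_hom(3)[OF usum_poly usum_poly])
qed (auto simp: rsub_def)

lemma u_nonzero: "u k \<noteq> 0"
proof -
  have "Poly_Mapping.single (Poly_Mapping.single k 1) 1 \<noteq> (0 :: mpoly)"
    by (metis lookup_single_eq lookup_zero one_neq_zero)
  then show ?thesis by (simp add: u_def fract_expand eq_fract)
qed

lemma usum_nonzero: "1 \<le> n \<Longrightarrow> usum 1 n \<noteq> 0"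
  using subst_eq_0_iff[OF good_csub[of 1 n], of "u 1"] by (simp add: csub_def u_nonzero)

lemma usum_shift: "(\<Sum>k=a..b. u (k + c)) = usum (a + c) (b + c)"
  by (simp add: usum_def sum.shift_bounds_cl_nat_ivl)

lemma usum_split: "a \<le> b \<Longrightarrow> b \<le> c + 1 \<Longrightarrow> 1 \<le> b \<Longrightarrow> usum a c = usum a (b - 1) + usum b c"
  unfolding usum_def by (subst sum.union_disjoint[symmetric]) (auto intro!: sum.cong)

lemma ssub_usum:
  assumes "1 \<le> i" "1 \<le> a" shows "(\<Sum>k=a..b. ssub i k) = usum (a + i - 1) (b + i - 1)"
  using usum_shift[of "i - 1" a b] assms by (simp add: ssub_def)

lemma csub_usum_less: "b < p \<Longrightarrow> (\<Sum>k=a..b. csub p n k) = usum a b"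
  by (simp add: csub_def usum_def)

lemma csub_usum_greater:
  assumes "p < a" "1 \<le> n" shows "(\<Sum>k=a..b. csub p n k) = usum (a + n - 1) (b + n - 1)"
  using usum_shift[of "n - 1" a b] assms by (simp add: csub_def)

lemma csub_usum:
  assumes "1 \<le> a" "a \<le> p" "p \<le> b" "1 \<le> n"
  shows "(\<Sum>k=a..b. csub p n k) = usum a (b + n - 1)"
proof -
  have "{a..b} = {a..p - 1} \<union> ({p} \<union> {p + 1..b})" using assms by auto
  then have "(\<Sum>k=a..b. csub p n k) = (\<Sum>k=a..p - 1. csub p n k) + (csub p n p + (\<Sum>k=p + 1..b. csub p n k))"
    using assms by (subst \<open>{a..b} = _\<close>, subst sum.union_disjoint) (auto simp: sum.union_disjoint)
  also have "\<dots> = usum a (p - 1) + (usum p (p + n - 1) + usum (p + n) (b + n - 1))"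
    using assms by (subst csub_usum_less, simp, subst csub_usum_greater) (auto simp: csub_def)
  also have "usum p (p + n - 1) + usum (p + n) (b + n - 1) = usum p (b + n - 1)"
    using usum_split[of p "p + n" "b + n - 1"] assms by simp
  also have "usum a (p - 1) + \<dots> = usum a (b + n - 1)"
    using usum_split[of a p "b + n - 1"] assms by simp
  finally show ?thesis .
qed

lemma rsub_usum:
  assumes "2 \<le> a" "b \<le> n" shows "(\<Sum>k=a..b. rsub n k) = usum (a - 1) (b - 1)"
proof (cases "b = 0")
  case False
  have "(\<Sum>k=a..b. rsub n k) = (\<Sum>k=(a - 1) + 1..(b - 1) + 1. u (k - 1))"
    using assms False by (intro sum.cong) (auto simp: rsub_def)
  also have "\<dots> = (\<Sum>k=a - 1..b - 1. u k)"
    by (subst sum.shift_bounds_cl_nat_ivl) simp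
  finally show ?thesis by (simp add: usum_def)
qed (use assms in \<open>simp add: usum_def\<close>)

lemma rsub_usum_1:
  assumes "1 \<le> b" "b \<le> n" shows "(\<Sum>k=1..b. rsub n k) = - usum b n"
proof -
  have "(\<Sum>k=1..b. rsub n k) = rsub n 1 + (\<Sum>k=2..b. rsub n k)"
    using assms by (simp add: sum.atLeast_Suc_atMost numeral_2_eq_2)
  also have "\<dots> = - usum 1 n + usum 1 (b - 1)"
    using assms rsub_usum[of 2 b n] by (simp add: rsub_def)
  also have "usum 1 n = usum 1 (b - 1) + usum b n"
    using assms by (intro usum_split) auto
  finally show ?thesis by simp
qed

lemma mould_comp_closed:
  assumes "f \<in> mould_space m" "g \<in> mould_space n" "1 \<le> i" "i \<le> m" "1 \<le> n"
  shows "mould_comp m n i f g \<in> mould_space (m + n - 1)"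
  unfolding mould_comp_altdef
proof (intro mould_closed(2))
  show "usum i (i + n - 1) \<in> mould_space (m + n - 1)" using assms by (intro mould_usum) auto
  show "subst (csub i n) f \<in> mould_space (m + n - 1)"
    by (rule subst_mould[OF good_csub assms(1)]) (use assms in \<open>auto simp: csub_def\<close>)
  show "subst (ssub i) g \<in> mould_space (m + n - 1)"
    by (rule subst_mould[OF good_ssub assms(2)]) (use assms in \<open>auto simp: ssub_def\<close>)
qed

lemma mould_rot_closed:
  assumes "f \<in> mould_space n" "1 \<le> n"
  shows "mould_rot n f \<in> mould_space n"
  unfolding mould_rot_altdef
  by (rule subst_mould[OF good_rsub assms(1)]) (use assms in \<open>auto simp: rsub_def intro!: mould_closed\<close>)

lemma mould_sequential:
  assumes "f \<in> mould_space l" "g \<in> mould_space m" "h \<in> mould_space n"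
    and i: "1 \<le> i" "i \<le> l" and j: "1 \<le> j" "j \<le> m" and n: "1 \<le> n"
  shows "mould_comp (l + m - 1) n (i - 1 + j) (mould_comp l m i f g) h =
    mould_comp l (m + n - 1) i f (mould_comp m n j g h)"
proof -
  define p where "p = i - 1 + j"
  have p: "1 \<le> p" and m: "1 \<le> m" using i j by (auto simp: p_def)
  note goods = good_csub[OF p n] good_csub[OF i(1) m] good_csub[OF j(1) n] good_ssub[OF i(1)]
    good_ssub[OF j(1)] good_ssub[OF p]
  have a: "(\<Sum>k=j..j + n - 1. ssub i k) = usum p (p + n - 1)"
    using ssub_usum[of i j "j + n - 1"] i j n by (simp add: p_def add_ac)
  have b: "(\<Sum>k=i..i + m - 1. csub p n k) = usum i (i + (m + n - 1) - 1)"
    using csub_usum[of i p "i + m - 1" n] i j n by (simp add: p_def add_ac)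
  have c: "(\<lambda>k. subst (csub p n) (csub i m k)) = csub i (m + n - 1)"
  proof
    fix k
    consider "k < i" | "k = i" | "i < k" by linarith
    then show "subst (csub p n) (csub i m k) = csub i (m + n - 1) k"
    proof cases
      case 2
      then show ?thesis using b by (simp add: csub_def[of i] subst_usum goods)
    qed (use i j n in \<open>auto simp: csub_def[of i], auto simp: csub_def p_def add_ac\<close>)
  qed
  have d: "(\<lambda>k. subst (csub p n) (ssub i k)) = (\<lambda>k. subst (ssub i) (csub j n k))"
  proof
    fix k
    consider "k < j" | "k = j" | "j < k" by linarith
    then show "subst (csub p n) (ssub i k) = subst (ssub i) (csub j n k)"
    proof cases
      case 2
      then have "csub p n (k + i - 1) = usum p (p + n - 1)" using i j by (simp add: csub_def p_def add_ac)
      then show ?thesis using a 2 by (simp add: csub_def[of j] ssub_def[of i j] subst_usum goods)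
    qed (use i j n in \<open>auto simp: csub_def ssub_def p_def add_ac\<close>)
  qed
  have e: "(\<lambda>k. subst (ssub i) (ssub j k)) = ssub p"
    using i j by (auto simp: ssub_def p_def fun_eq_iff add_ac)
  show ?thesis
    unfolding p_def[symmetric] mould_comp_altdef
    by (simp only: subst_mult goods subst_subst subst_usum a b c d e mult_ac)
qed

lemma mould_parallel:
  assumes f: "f \<in> mould_space l" and g: "g \<in> mould_space m" and h: "h \<in> mould_space n"
    and i: "1 \<le> i" "i < k" "k \<le> l" and m: "1 \<le> m" and n: "1 \<le> n"
  shows "mould_comp (l + m - 1) n (k - 1 + m) (mould_comp l m i f g) h =
    mould_comp (l + n - 1) m i (mould_comp l n k f h) g"
proof -
  define q where "q = k - 1 + m"
  have q: "1 \<le> q" and k: "1 \<le> k" using i m by (auto simp: q_def)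
  note goods = good_csub[OF q n] good_csub[OF i(1) m] good_csub[OF k n] good_ssub[OF i(1)]
    good_ssub[OF k] good_ssub[OF q]
  have a: "(\<Sum>x=i..i + m - 1. csub q n x) = usum i (i + m - 1)"
    using i m by (intro csub_usum_less) (simp add: q_def)
  have b: "(\<Sum>x=k..k + n - 1. csub i m x) = usum q (q + n - 1)"
    using csub_usum_greater[OF i(2) m, of "k + n - 1"] i m n by (simp add: q_def algebra_simps)
  have c: "(\<lambda>x. subst (csub q n) (csub i m x)) = (\<lambda>x. subst (csub i m) (csub k n x))"
  proof
    fix x
    consider "x < i" | "x = i" | "i < x" "x < k" | "x = k" | "k < x" by linarith
    then show "subst (csub q n) (csub i m x) = subst (csub i m) (csub k n x)"
    proof cases
      case 2
      then have "csub i m x = usum i (i + m - 1)" "csub k n x = u i" using i by (auto simp: csub_def)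
      then show ?thesis using a 2 by (simp add: subst_usum goods)
    next
      case 4
      then have "csub i m x = u q" "csub k n x = usum k (k + n - 1)" "csub q n q = usum q (q + n - 1)"
        using i m by (auto simp: csub_def q_def)
      then show ?thesis using b 4 by (simp add: subst_usum goods)
    qed (use i m n in \<open>auto simp: csub_def q_def add_ac\<close>)
  qed
  have d: "subst (csub q n) (subst (ssub i) g) = subst (ssub i) g"
    unfolding subst_subst[OF goods(1) goods(4)]
    by (rule subst_cong[OF good_compose[OF goods(1) goods(4)] goods(4) g])
      (use i in \<open>auto simp: ssub_def csub_def q_def\<close>)
  have e: "subst (csub i m) (subst (ssub k) h) = subst (ssub q) h"
    unfolding subst_subst[OF goods(2) goods(5)]
    by (rule subst_cong[OF good_compose[OF goods(2) goods(5)] goods(6) h])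
      (use i m in \<open>auto simp: ssub_def csub_def q_def add_ac\<close>)
  show ?thesis
    unfolding q_def[symmetric] mould_comp_altdef
    by (simp only: subst_mult goods d e) (simp only: goods subst_subst subst_usum a b c mult_ac)
qed

lemma mould_rot_comp:
  assumes f: "f \<in> mould_space m" and g: "g \<in> mould_space n" and i: "2 \<le> i" "i \<le> m" and n: "1 \<le> n"
  shows "mould_rot (m + n - 1) (mould_comp m n i f g) = mould_comp m n (i - 1) (mould_rot m f) g"
proof -
  define N where "N = m + n - 1"
  have *: "1 \<le> N" "1 \<le> i" "1 \<le> i - 1" "1 \<le> m" using i n by (auto simp: N_def)
  note goods = good_rsub[OF *(1)] good_csub[OF *(2) n] good_ssub[OF *(2)]
    good_csub[OF *(3) n] good_ssub[OF *(3)] good_rsub[OF *(4)]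
  have a: "(\<Sum>k=i..i + n - 1. rsub N k) = usum (i - 1) (i - 1 + n - 1)"
    using rsub_usum[of i "i + n - 1" N] i n by (simp add: N_def)
  have b: "(\<Sum>k=1..m. csub (i - 1) n k) = usum 1 N"
    using csub_usum[of 1 "i - 1" m n] i n by (simp add: N_def)
  have c: "subst (rsub N) (subst (csub i n) f) = subst (csub (i - 1) n) (subst (rsub m) f)"
    unfolding subst_subst[OF goods(1,2)] subst_subst[OF goods(4,6)]
  proof (rule subst_cong[OF good_compose[OF goods(1,2)] good_compose[OF goods(4,6)] f])
    fix x assume x: "1 \<le> x" "x \<le> m"
    consider "x = 1" | "2 \<le> x" "x < i" | "x = i" | "i < x" using x by linarith
    then show "subst (rsub N) (csub i n x) = subst (csub (i - 1) n) (rsub m x)"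
    proof cases
      case 1
      then have "csub i n x = u 1" "rsub m x = - usum 1 m" using i by (auto simp: csub_def rsub_def)
      moreover have "rsub N 1 = - usum 1 N" by (simp add: rsub_def)
      ultimately show ?thesis using b by (simp add: subst_uminus subst_usum goods del: One_nat_def)
    next
      case 3
      then have "csub i n x = usum i (i + n - 1)" "rsub m x = u (i - 1)" "csub (i - 1) n (i - 1) = usum (i - 1) (i - 1 + n - 1)"
        using i by (auto simp: csub_def rsub_def)
      then show ?thesis using a by (simp add: subst_usum goods del: One_nat_def)
    qed (use i n x in \<open>auto simp: csub_def rsub_def N_def\<close>)
  qed
  have d: "subst (rsub N) (subst (ssub i) g) = subst (ssub (i - 1)) g"
    unfolding subst_subst[OF goods(1,3)]
    by (rule subst_cong[OF good_compose[OF goods(1,3)] goods(5) g])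
      (use i in \<open>auto simp: ssub_def rsub_def N_def\<close>)
  show ?thesis
    unfolding N_def[symmetric] mould_comp_altdef mould_rot_altdef
    by (simp only: subst_mult goods c d) (simp only: goods subst_usum a)
qed

lemma mould_rot_comp_1:
  assumes f: "f \<in> mould_space m" and g: "g \<in> mould_space n" and m: "1 \<le> m" and n: "1 \<le> n"
  shows "mould_rot (m + n - 1) (mould_comp m n 1 f g) = - mould_comp n m n (mould_rot n g) (mould_rot m f)"
proof -
  define N where "N = m + n - 1"
  have *: "1 \<le> N" using m n by (auto simp: N_def)
  note goods = good_rsub[OF *] good_csub[OF order_refl n] good_ssub[OF order_refl]
    good_csub[OF n m] good_rsub[OF n] good_ssub[OF n] good_rsub[OF m]
  have a: "(\<Sum>k=1..n. rsub N k) = - usum n (n + m - 1)"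
    using rsub_usum_1[of n N] m n by (simp add: N_def add.commute)
  have b: "(\<Sum>k=1..m. ssub n k) = usum n (n + m - 1)"
    using ssub_usum[of n 1 m] n by (simp add: add.commute)
  have c: "(\<Sum>k=1..n. csub n m k) = usum 1 N"
    using csub_usum[of 1 n n m] m n by (simp add: N_def add.commute)
  have N1: "rsub N 1 = - usum 1 N" by (simp add: rsub_def)
  have d: "subst (rsub N) (subst (csub 1 n) f) = subst (ssub n) (subst (rsub m) f)"
    unfolding subst_subst[OF goods(1,2)] subst_subst[OF goods(6,7)]
  proof (rule subst_cong[OF good_compose[OF goods(1,2)] good_compose[OF goods(6,7)] f])
    fix x assume x: "1 \<le> x" "x \<le> m"
    show "subst (rsub N) (csub 1 n x) = subst (ssub n) (rsub m x)"
    proof (cases "x = 1")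
      case True
      then have "csub 1 n x = usum 1 n" "rsub m x = - usum 1 m" by (auto simp: csub_def rsub_def)
      then show ?thesis using a b by (simp add: subst_uminus subst_usum goods del: One_nat_def)
    qed (use n x in \<open>auto simp: csub_def rsub_def ssub_def N_def\<close>)
  qed
  have e: "subst (rsub N) (subst (ssub 1) g) = subst (csub n m) (subst (rsub n) g)"
    unfolding subst_subst[OF goods(1,3)] subst_subst[OF goods(4,5)]
  proof (rule subst_cong[OF good_compose[OF goods(1,3)] good_compose[OF goods(4,5)] g])
    fix x assume x: "1 \<le> x" "x \<le> n"
    show "subst (rsub N) (ssub 1 x) = subst (csub n m) (rsub n x)"
    proof (cases "x = 1")
      case True
      then have "ssub 1 x = u 1" "rsub n x = - usum 1 n" by (auto simp: ssub_def rsub_def)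
      then show ?thesis using c N1 by (simp add: subst_uminus subst_usum goods del: One_nat_def)
    qed (use m x in \<open>auto simp: csub_def rsub_def ssub_def N_def\<close>)
  qed
  have "1 + n - 1 = n" by simp
  then show ?thesis
    unfolding N_def[symmetric] mould_comp_altdef mould_rot_altdef
    by (simp only: subst_mult goods d e) (simp only: goods subst_usum a mult_ac mult_minus_left mult_minus_right)
qed

lemma mould_rot_order:
  assumes f: "f \<in> mould_space n" and n: "1 \<le> n"
  shows "(mould_rot n ^^ (n + 1)) f = f"
proof -
  let ?S = "subst (rsub n)"
  note g = good_rsub[OF n]
  define v where "v j = (if j = 0 then - usum 1 n else u j)" for j
  have step: "?S (v (Suc j)) = v j" if "Suc j \<le> n" for j
    using that by (auto simp: v_def rsub_def)
  have wrap: "?S (v 0) = v n"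
    proof -
    have "usum n n = u n" by (simp add: usum_def)
    then show ?thesis using rsub_usum_1[OF n order_refl] n by (simp add: v_def subst_uminus subst_usum g)
  qed
  have down: "(?S ^^ k) (v j) = v (j - k)" if "k \<le> j" "j \<le> n" for j k
    using that
  proof (induction k)
    case (Suc k)
    then show ?case using step[of "j - Suc k"] by (simp add: Suc_diff_Suc)
  qed simp
  have cyc: "(?S ^^ (n + 1)) (v j) = v j" if "j \<le> n" for j
  proof -
    have "n + 1 = (n - j) + (1 + j)" using that by simp
    then have "(?S ^^ (n + 1)) (v j) = (?S ^^ (n - j)) ((?S ^^ (1 + j)) (v j))"
      by (simp only: funpow_add comp_apply)
    also have "(?S ^^ (1 + j)) (v j) = ?S ((?S ^^ j) (v j))" by simp
    also have "(?S ^^ (n - j)) (?S ((?S ^^ j) (v j))) = v j" using down[of j j] down[of "n - j" n] that by (simp add: wrap)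
    finally show ?thesis .
  qed
  have gk: "good_subst (\<lambda>j. (?S ^^ k) (u j)) \<and> (?S ^^ k) h = subst (\<lambda>j. (?S ^^ k) (u j)) h" for k h
  proof (induction k)
    case 0
    then show ?case using good_u by (simp add: subst_u_id)
  next
    case (Suc k)
    then show ?case using good_compose[OF g] subst_subst[OF g] by auto
  qed
  have "(mould_rot n ^^ (n + 1)) f = (?S ^^ (n + 1)) f"
    by (simp add: mould_rot_altdef[abs_def])
  also have "\<dots> = subst (\<lambda>j. (?S ^^ (n + 1)) (u j)) f" using gk by blast
  also have "\<dots> = subst u f"
  proof (rule subst_cong[OF _ good_u f])
    show "good_subst (\<lambda>j. (?S ^^ (n + 1)) (u j))" using gk by blast
    fix j assume "1 \<le> j" "j \<le> n"
    then show "(?S ^^ (n + 1)) (u j) = u j" using cyc[of j] by (simp add: v_def)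
  qed
  finally show ?thesis by (simp add: subst_u_id)
qed

lemma anticyclic_operad_Mould: "anticyclic_operad Mould"
proof -
  interpret vector_space "\<lambda>c f. const c * f"
    by standard (simp_all add: algebra_simps const_add const_mult)
  have vs: "vector_space (\<lambda>c f. const c * f)" ..
  have sub: "subspace (mould_space n)" for n
    unfolding subspace_def by blast
  have unit_left: "mould_comp 1 n 1 (1 / u 1) g = g" if "1 \<le> n" for n g
  proof -
    have "subst (csub 1 n) (1 / u 1) = 1 / usum 1 n"
      by (subst subst_divide[OF good_csub[OF order_refl that]]) (simp add: csub_def)
    moreover have "ssub 1 = u" by (simp add: ssub_def fun_eq_iff)
    ultimately show ?thesis
      using usum_nonzero[OF that] by (simp add: mould_comp_altdef subst_u_id)
  qed
  have unit_right: "mould_comp m 1 i f (1 / u 1) = f" if "1 \<le> i" for m i f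
  proof -
    have "subst (ssub i) (1 / u 1) = 1 / u i"
      by (subst subst_divide[OF good_ssub[OF that]]) (simp add: ssub_def)
    moreover have "csub i 1 = u" by (auto simp: csub_def fun_eq_iff usum_def)
    ultimately show ?thesis
      using u_nonzero by (simp add: mould_comp_altdef subst_u_id usum_def)
  qed
  have rot_unit: "mould_rot 1 (1 / u 1) = - (1 / u 1)"
    unfolding mould_rot_altdef
    by (subst subst_divide[OF good_rsub[OF order_refl]]) (simp add: rsub_def usum_def)
  have unit: "1 / u 1 \<in> mould_space 1" by (intro mould_divide mould_u mould_0) auto
  note lin = mould_comp_altdef mould_rot_altdef subst_add subst_mult good_ssub good_csub good_rsub
     distrib_left distrib_right mult_ac
  show "anticyclic_operad Mould"
    unfolding anticyclic_operad_def ns_operad_def anticyclic_operad_axioms_def ns_operad_axioms_def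
      Mould_def operad.select_convs anticyclic.select_convs
    by (intro conjI allI impI vs sub unit unit_left unit_right rot_unit mould_comp_closed mould_rot_closed
      mould_sequential mould_parallel mould_rot_order mould_rot_comp mould_rot_comp_1; 
      (assumption | simp add: lin))
qed

end

theory Submission
  imports Defs
begin

text \<open>
  The dendriform operad has a universal property: for an anticyclic operad \<open>Q\<close> and elements
  \<open>a\<close>, \<open>b\<close> of \<open>Q(2)\<close> that satisfy the three dendriform relations, with \<open>\<tau> a = b\<close> and
  \<open>\<tau> b = - (a + b)\<close>, there is exactly one morphism of anticyclic operads from \<open>Dend\<close> to \<open>Q\<close> that
  maps the generators to \<open>a\<close> and \<open>b\<close>.

  Every labelled tree is an iterated composition of corollas, so a morphism is determined by its
  values on the generators.  Conversely, the tree \<open>\<langle>l, x, r\<rangle> = (x \<circ>\<^sub>2 r) \<circ>\<^sub>1 l\<close> can be evaluated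
  recursively in \<open>Q\<close>.  The axioms of sequential and parallel composition turn grafting of trees
  into composition in \<open>Q\<close> (\<open>tree_val_graft\<close>), and the axioms for \<open>\<tau>\<close> make the evaluation
  commute with rotation, because it does so on corollas (\<open>tree_val_rot\<close>).  The linear extension
  of the evaluation kills the dendriform ideal in each arity (\<open>val_ideal\<close>), and therefore
  descends to \<open>Dend\<close>.

  For \<open>Mould\<close> it remains to check the hypotheses on \<open>a = 1 / (u\<^sub>1 (u\<^sub>1 + u\<^sub>2))\<close> and
  \<open>b = 1 / ((u\<^sub>1 + u\<^sub>2) u\<^sub>2)\<close>.  They are identities of rational functions in at most three
  variables; where \<open>a + b\<close> occurs, it is replaced by \<open>1 / (u\<^sub>1 u\<^sub>2)\<close>.
\<close>

section \<open>Evaluation of trees in an anticyclic operad\<close>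

text \<open>
  An anticyclic operad \<open>Q\<close> with two chosen elements of arity 2 that behave as the generators
  \<open>L\<close> and \<open>R\<close> of \<open>Dend\<close>.
\<close>

locale dendriform_pair = anticyclic_operad Q
  for Q :: "('a::ab_group_add, 'z) anticyclic_scheme" +
  fixes a b :: 'a
  assumes a_closed: "a \<in> space Q 2"
    and b_closed: "b \<in> space Q 2"
    and relation_1: "comp Q 2 2 1 a (a + b) = comp Q 2 2 2 a a"
    and relation_2: "comp Q 2 2 1 b a = comp Q 2 2 2 a b"
    and relation_3: "comp Q 2 2 1 b b = comp Q 2 2 2 b (a + b)"
    and rot_a: "rot Q 2 a = b"
    and rot_b: "rot Q 2 b = - (a + b)"
begin

lemma space_0: "1 \<le> n \<Longrightarrow> 0 \<in> space Q n"
  using subspace_space subspace_0 by blast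

lemma space_add: "1 \<le> n \<Longrightarrow> f \<in> space Q n \<Longrightarrow> g \<in> space Q n \<Longrightarrow> f + g \<in> space Q n"
  using subspace_space subspace_add by blast

lemma space_scale: "1 \<le> n \<Longrightarrow> f \<in> space Q n \<Longrightarrow> scale Q c f \<in> space Q n"
  using subspace_space subspace_scale by blast

lemma comp_0_left: "\<lbrakk>g \<in> space Q n; 1 \<le> i; i \<le> m; 1 \<le> n\<rbrakk> \<Longrightarrow> comp Q m n i 0 g = 0"
  using comp_scale_left[of 0 m g n i 0] space_0[of m] by simp

lemma comp_0_right: "\<lbrakk>f \<in> space Q m; 1 \<le> i; i \<le> m; 1 \<le> n\<rbrakk> \<Longrightarrow> comp Q m n i f 0 = 0"
  using comp_scale_right[of f m 0 n i 0] space_0[of n] by simp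

lemma rot_0: "1 \<le> n \<Longrightarrow> rot Q n 0 = 0"
  using rot_scale[of 0 n 0] space_0[of n] by simp

text \<open>The element of \<open>Q\<close> chosen for a generator of the free operad.\<close>

fun gen_val :: "dgen \<Rightarrow> 'a"
  where
    "gen_val Gen_L = a"
  | "gen_val Gen_R = b"

text \<open>The image in \<open>Q\<close> of a labelled tree under the substitution of \<open>a\<close> and \<open>b\<close> for the labels.\<close>

fun tree_val :: "dtree \<Rightarrow> 'a"
  where
    "tree_val \<langle>\<rangle> = unit Q"
  | "tree_val \<langle>l, x, r\<rangle> = comp Q (size1 r + 1) (size1 l) 1
      (comp Q 2 (size1 r) 2 (gen_val x) (tree_val r)) (tree_val l)"

text \<open>
  The linear extension of \<open>tree_val\<close> to the component of arity \<open>n\<close>; the components of other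
  arities are mapped to \<open>0\<close>.
\<close>

definition val :: "nat \<Rightarrow> free \<Rightarrow> 'a"
  where "val n x = (\<Sum>t\<in>Poly_Mapping.keys x.
    if size1 t = n then scale Q (Poly_Mapping.lookup x t) (tree_val t) else 0)"

lemma gen_val_closed: "gen_val x \<in> space Q 2"
  by (cases x) (simp_all add: a_closed b_closed)

lemma comp_gen_closed:
  "f \<in> space Q n \<Longrightarrow> 1 \<le> n \<Longrightarrow> comp Q 2 n 2 (gen_val x) f \<in> space Q (n + 1)"
  using comp_closed[OF gen_val_closed, of f n 2 x] by simp

lemma tree_val_closed: "tree_val t \<in> space Q (size1 t)"
proof (induction t)
  case (Node l x r)
  have "comp Q 2 (size1 r) 2 (gen_val x) (tree_val r) \<in> space Q (size1 r + 1)"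
    using Node.IH(2) by (rule comp_gen_closed) simp
  from comp_closed[OF this Node.IH(1), of 1] show ?case by (simp add: add.commute)
qed (use unit_closed in simp)

lemma tree_val_corolla: "tree_val \<langle>\<langle>\<rangle>, x, \<langle>\<rangle>\<rangle> = gen_val x"
  using comp_unit_right[OF gen_val_closed, of 2 x] comp_unit_right[OF gen_val_closed, of 1 x]
  by (simp add: numeral_2_eq_2)

lemma tree_val_graft:
  "\<lbrakk>1 \<le> i; i \<le> size1 t\<rbrakk>
    \<Longrightarrow> tree_val (graft i t s) = comp Q (size1 t) (size1 s) i (tree_val t) (tree_val s)"
proof (induction t arbitrary: i)
  case Leaf
  then have "i = 1" by simp
  with comp_unit_left[OF tree_val_closed, of s] show ?case by simp
next
  case (Node l x r)
  let ?X = "comp Q 2 (size1 r) 2 (gen_val x) (tree_val r)"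
  have X: "?X \<in> space Q (size1 r + 1)"
    using tree_val_closed by (rule comp_gen_closed) simp
  show ?case
  proof (cases "i \<le> size1 l")
    case True
    have "tree_val (graft i \<langle>l, x, r\<rangle> s) = comp Q (size1 r + 1) (size1 l + size1 s - 1) 1 ?X
        (comp Q (size1 l) (size1 s) i (tree_val l) (tree_val s))"
      using True Node by (simp add: size1_graft)
    also have "\<dots> = comp Q (size1 r + 1 + size1 l - 1) (size1 s) (1 - 1 + i)
        (comp Q (size1 r + 1) (size1 l) 1 ?X (tree_val l)) (tree_val s)"
      by (rule comp_sequential[symmetric, OF X tree_val_closed tree_val_closed])
        (use True Node.prems in auto)
    finally show ?thesis by (simp add: add.commute)
  next
    case False
    define j where "j = i - size1 l"
    have j: "1 \<le> j" "j \<le> size1 r" "i = size1 l + j"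
      using False Node.prems by (auto simp: j_def)
    have "tree_val (graft i \<langle>l, x, r\<rangle> s) = comp Q (size1 r + size1 s - 1 + 1) (size1 l) 1
        (comp Q 2 (size1 r + size1 s - 1) 2 (gen_val x)
          (comp Q (size1 r) (size1 s) j (tree_val r) (tree_val s))) (tree_val l)"
      using False Node.IH(2)[OF j(1,2)] size1_graft[OF j(1,2), of s] by (simp add: j_def)
    also have "comp Q 2 (size1 r + size1 s - 1) 2 (gen_val x)
          (comp Q (size1 r) (size1 s) j (tree_val r) (tree_val s)) =
        comp Q (2 + size1 r - 1) (size1 s) (2 - 1 + j) ?X (tree_val s)"
      by (rule comp_sequential[symmetric, OF gen_val_closed tree_val_closed tree_val_closed])
        (use j in auto)
    also have "comp Q (size1 r + size1 s - 1 + 1) (size1 l) 1 \<dots> (tree_val l) =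
        comp Q (size1 r + 1 + size1 s - 1) (size1 l) 1
          (comp Q (size1 r + 1) (size1 s) (1 + j) ?X (tree_val s)) (tree_val l)"
      using size1_pos(1)[of s] by (simp add: add.commute)
    also have "\<dots> = comp Q (size1 r + 1 + size1 l - 1) (size1 s) (1 + j - 1 + size1 l)
          (comp Q (size1 r + 1) (size1 l) 1 ?X (tree_val l)) (tree_val s)"
      by (rule comp_parallel[symmetric, OF X tree_val_closed tree_val_closed])
        (use j in auto)
    finally show ?thesis using j by (simp add: add.commute)
  qed
qed


section \<open>The linear extension of the evaluation\<close>

lemma val_superset:
  assumes "finite A" "Poly_Mapping.keys x \<subseteq> A"
  shows "val n x =
    (\<Sum>t\<in>A. if size1 t = n then scale Q (Poly_Mapping.lookup x t) (tree_val t) else 0)"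
  unfolding val_def
  by (rule sum.mono_neutral_left) (use assms in \<open>auto simp: in_keys_iff\<close>)

lemma val_0 [simp]: "val n 0 = 0"
  by (simp add: val_def)

lemma val_add: "val n (x + y) = val n x + val n y"
  using keys_add[of x y]
  by (auto simp: val_superset[where A = "Poly_Mapping.keys x \<union> Poly_Mapping.keys y"]
      lookup_add scale_left_distrib simp flip: sum.distrib intro!: sum.cong)

lemma val_scale: "val n (free_scale c x) = scale Q c (val n x)"
proof -
  have "Poly_Mapping.keys (free_scale c x) \<subseteq> Poly_Mapping.keys x"
    by (auto simp: in_keys_iff)
  then show ?thesis
    by (auto simp: val_superset[where A = "Poly_Mapping.keys x"] scale_sum_right intro!: sum.cong)
qed

lemma val_basis: "val n (basis t) = (if size1 t = n then tree_val t else 0)"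
  by (simp add: val_def lookup_single)

lemma val_neg: "val n (- x) = - val n x"
  using val_add[of n x "- x"] by (simp add: minus_unique)

lemma val_diff: "val n (x - y) = val n x - val n y"
  using val_add[of n x "- y"] by (simp add: val_neg)

lemma val_closed:
  assumes "1 \<le> n"
  shows "val n x \<in> space Q n"
proof (induction x rule: free_induct)
  case (basis c t)
  show ?case
    using tree_val_closed[of t] assms by (auto simp: val_scale val_basis space_scale space_0)
qed (simp_all add: val_add space_0[OF assms] space_add[OF assms])

lemma val_corolla: "val 2 (corolla x) = gen_val x"
  by (simp add: val_basis tree_val_corolla del: tree_val.simps)

text \<open>
  The arity \<open>n\<close> component of \<open>x \<circ>\<^sub>i s\<close>, for a tree \<open>s\<close>, comes from the component of arity
  \<open>n + 1 - size1 s\<close> of \<open>x\<close> only.  If \<open>n < size1 s\<close> this difference is \<open>0\<close>, and no position \<open>i\<close>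
  is available.
\<close>

lemma val_comp_basis_right:
  fixes n s
  defines "m \<equiv> n + 1 - size1 s"
  shows "val n (free_comp i x (basis s)) =
    (if 1 \<le> i \<and> i \<le> m then comp Q m (size1 s) i (val m x) (tree_val s) else 0)"
proof (induction x rule: free_induct)
  case zero
  show ?case by (simp add: fc_simps comp_0_left tree_val_closed)
next
  case (add x y)
  then show ?case by (simp add: fc_simps val_add comp_add_left val_closed tree_val_closed)
next
  case (basis c t)
  have "val n (free_comp i (basis t) (basis s)) =
      (if 1 \<le> i \<and> i \<le> m then comp Q m (size1 s) i (val m (basis t)) (tree_val s) else 0)"
    using size1_graft[of i t s] size1_pos(1)[of s] size1_pos(1)[of t]
    by (auto simp: free_comp_basis val_basis tree_val_graft comp_0_left tree_val_closed m_def)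
  then show ?case
    by (simp add: fc_simps val_scale comp_scale_left val_closed tree_val_closed)
qed

lemma val_comp_basis_left:
  fixes n s
  defines "m \<equiv> n + 1 - size1 s"
  shows "val n (free_comp i (basis s) x) =
    (if 1 \<le> i \<and> i \<le> size1 s \<and> 1 \<le> m then comp Q (size1 s) m i (tree_val s) (val m x) else 0)"
proof (induction x rule: free_induct)
  case zero
  show ?case by (simp add: fc_simps comp_0_right tree_val_closed)
next
  case (add x y)
  then show ?case by (simp add: fc_simps val_add comp_add_right val_closed tree_val_closed)
next
  case (basis c t)
  have "val n (free_comp i (basis s) (basis t)) =
      (if 1 \<le> i \<and> i \<le> size1 s \<and> 1 \<le> m
       then comp Q (size1 s) m i (tree_val s) (val m (basis t)) else 0)"
    using size1_graft[of i s t] size1_pos(1)[of s] size1_pos(1)[of t]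
    by (auto simp: free_comp_basis val_basis tree_val_graft comp_0_right tree_val_closed m_def)
  then show ?case
    by (simp add: fc_simps val_scale comp_scale_right val_closed tree_val_closed)
qed

lemma val_comp:
  assumes "y \<in> free_space n" "1 \<le> i" "i \<le> m" "1 \<le> n"
  shows "val (m + n - 1) (free_comp i x y) = comp Q m n i (val m x) (val n y)"
  using assms(1)
proof (induction y rule: free_space_induct)
  case zero
  show ?case using assms by (simp add: fc_simps comp_0_right val_closed)
next
  case (add y z)
  then show ?case using assms by (simp add: fc_simps val_add comp_add_right val_closed)
next
  case (basis c s)
  then have "m + n - 1 + 1 - size1 s = m" using assms by simp
  with basis val_comp_basis_right[of "m + n - 1" i x s]
  have "val (m + n - 1) (free_comp i x (basis s)) = comp Q m n i (val m x) (val n (basis s))"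
    using assms by (simp add: val_basis)
  with basis show ?case
    using assms by (simp add: fc_simps val_scale comp_scale_right val_closed)
qed

lemma val_gen_rot: "val 2 (gen_rot x) = rot Q 2 (gen_val x)"
  by (cases x) (simp_all add: val_add val_diff val_neg val_corolla rot_a rot_b del: minus_add_distrib)

lemma tree_val_rot: "val (size1 t) (tree_rot t) = rot Q (size1 t) (tree_val t)"
proof (induction t)
  case Leaf
  show ?case using rot_unit by (simp add: val_neg val_basis)
next
  case (Node l x r)
  let ?X = "comp Q 2 (size1 r) 2 (gen_val x) (tree_val r)"
  let ?Y = "free_comp 1 (gen_rot x) (basis r)"
  have X: "?X \<in> space Q (size1 r + 1)"
    using tree_val_closed by (rule comp_gen_closed) simp
  have Y: "?Y \<in> free_space (size1 r + 1)"
    using free_comp_closed[OF gen_rot_closed basis_in_space, of 1 x r] by simp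
  have "val (2 + size1 r - 1) ?Y = comp Q 2 (size1 r) 1 (rot Q 2 (gen_val x)) (tree_val r)"
    by (subst val_comp[OF basis_in_space]) (auto simp: val_gen_rot val_basis)
  also have "\<dots> = rot Q (2 + size1 r - 1) ?X"
    using rot_comp[OF gen_val_closed[of x] tree_val_closed[of r], of 2] by simp
  finally have XY: "val (size1 r + 1) ?Y = rot Q (size1 r + 1) ?X" by simp
  have "val (size1 l + (size1 r + 1) - 1) (tree_rot \<langle>l, x, r\<rangle>) =
      - comp Q (size1 l) (size1 r + 1) (size1 l)
        (rot Q (size1 l) (tree_val l)) (rot Q (size1 r + 1) ?X)"
    unfolding tree_rot.simps val_neg by (subst val_comp[OF Y]) (simp_all add: Node.IH XY[simplified])
  also have "\<dots> = rot Q (size1 r + 1 + size1 l - 1) (tree_val \<langle>l, x, r\<rangle>)"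
    using rot_comp_1[OF X tree_val_closed[of l]] by simp
  finally show ?case by (simp add: add.commute)
qed

lemma val_rot:
  assumes "x \<in> free_space n" "1 \<le> n"
  shows "val n (free_rot x) = rot Q n (val n x)"
  using assms(1)
proof (induction x rule: free_space_induct)
  case (basis c t)
  then show ?case
    using tree_val_rot[of t] tree_val_closed[of t]
    by (auto simp: fr_simps val_scale val_basis rot_scale)
qed (use assms(2) in \<open>simp_all add: fr_simps val_add rot_add rot_0 val_closed\<close>)

text \<open>
  The ideal contains inhomogeneous elements, whence the statement about all arities at once, which
  is what the induction needs.
\<close>

lemma val_ideal:
  assumes "x \<in> dend_ideal"
  shows "val n x = 0"
  using assms
proof (induction arbitrary: n)
  have c2: "corolla x \<in> free_space 2" for x by (simp add: free_space_def)
  have cl: "free_comp i x y \<in> free_space 3" if "x \<in> free_space 2" "y \<in> free_space 2" for i x y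
    using free_comp_closed[OF that] by simp
  have c: "val 3 (free_comp i x y) = comp Q 2 2 i (val 2 x) (val 2 y)"
    if "y \<in> free_space 2" "1 \<le> i" "i \<le> 2" for i x y
    using val_comp[OF that, of x] by simp
  have off: "val n x = 0" if "x \<in> free_space 3" "n \<noteq> 3" for n x
    using that by (auto simp: val_def free_space_def intro!: sum.neutral)
  have hom: "val n x = 0" if "x \<in> free_space 3" "val 3 x = 0" for n x
    using off[OF that(1), of n] that(2) by (cases "n = 3") auto
  note simps = val_diff c c2 fs_closed val_add val_corolla
  {
    case rel1
    show ?case
      by (rule hom) (intro fs_closed cl c2, simp add: simps relation_1 del: One_nat_def)
  next
    case rel2
    show ?case
      by (rule hom) (intro fs_closed cl c2, simp add: simps relation_2 del: One_nat_def)
  next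
    case rel3
    show ?case
      by (rule hom) (intro fs_closed cl c2, simp add: simps relation_3 del: One_nat_def)
  }
next
  case (comp_left x i y)
  show ?case
    by (induction y rule: free_induct)
      (simp_all add: fc_simps val_add val_scale val_comp_basis_right comp_left.IH comp_0_left
        tree_val_closed)
next
  case (comp_right x i y)
  show ?case
    by (induction y rule: free_induct)
      (simp_all add: fc_simps val_add val_scale val_comp_basis_left comp_right.IH comp_0_right
        tree_val_closed)
qed (simp_all add: val_add val_scale)


section \<open>The universal property of the dendriform operad\<close>

text \<open>The morphism induced by \<open>val\<close> on the quotient, made extensional.\<close>

definition dend_val :: "nat \<Rightarrow> dend \<Rightarrow> 'a"
  where "dend_val =
    restrict (\<lambda>n. restrict (\<lambda>f. val n (rep_dend f)) (dend_space n)) {1..}"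

lemma dend_val_abs:
  assumes "1 \<le> n" "x \<in> free_space n"
  shows "dend_val n (abs_dend x) = val n x"
proof -
  have "dend_rel (rep_dend (abs_dend x)) x"
    using Quotient3_rep_abs[OF Quotient3_dend] by (simp add: dend_rel_def dend_ideal_0)
  then have "val n (rep_dend (abs_dend x)) = val n x"
    using val_ideal[of "rep_dend (abs_dend x) - x" n] by (simp add: dend_rel_def val_diff)
  then show ?thesis using assms by (simp add: dend_val_def dend_spaceI)
qed

lemma dend_val_generators: "dend_val 2 dend_L = a" "dend_val 2 dend_R = b"
  using dend_val_abs[of 2 "corolla x" for x]
  by (simp_all add: dend_L.abs_eq dend_R.abs_eq free_space_def val_corolla)

lemma anticyclic_operad_morphism_dend_val: "anticyclic_operad_morphism Dend Q dend_val"
proof -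
  interpret D: anticyclic_operad Dend by (rule anticyclic_operad_Dend)
  have unit: "basis \<langle>\<rangle> \<in> free_space 1"
    using basis_in_space[of "\<langle>\<rangle>"] by simp
  have sels: "space Dend = dend_space" "scale Dend = dend_scale" "unit Dend = dend_unit"
    "comp Dend = (\<lambda>m n. dend_comp)" "rot Dend = (\<lambda>n. dend_rot)"
    by (simp_all add: Dend_def)
  show ?thesis
  proof unfold_locales
    show "dend_val \<in> (\<Pi>\<^sub>E n\<in>{1..}. space Dend n \<rightarrow>\<^sub>E space Q n)"
      by (auto simp: dend_val_def sels val_closed)
    show "dend_val 1 (unit Dend) = unit Q"
      using dend_val_abs[OF _ unit] by (simp add: sels dend_unit.abs_eq val_basis)
  next
    fix n f g
    assume "1 \<le> n" "f \<in> space Dend n" "g \<in> space Dend n"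
    then show "dend_val n (f + g) = dend_val n f + dend_val n g"
      by (auto simp: sels abs_simps dend_val_abs fs_closed val_add elim!: dend_spaceE)
  next
    fix n f c
    assume "1 \<le> n" "f \<in> space Dend n"
    then show "dend_val n (scale Dend c f) = scale Q c (dend_val n f)"
      by (auto simp: sels abs_simps dend_val_abs fs_closed val_scale elim!: dend_spaceE)
  next
    fix f g m n i
    assume *: "f \<in> space Dend m" "g \<in> space Dend n" "1 \<le> i" "i \<le> m" "(1::nat) \<le> n"
    then obtain x y where "x \<in> free_space m" "f = abs_dend x" "y \<in> free_space n" "g = abs_dend y"
      by (auto simp: sels elim!: dend_spaceE)
    with * show "dend_val (m + n - 1) (comp Dend m n i f g) =
        comp Q m n i (dend_val m f) (dend_val n g)"
      by (simp add: sels abs_simps dend_val_abs free_comp_closed[simplified] val_comp[simplified])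
  next
    fix n f
    assume "1 \<le> n" "f \<in> space Dend n"
    then show "dend_val n (rot Dend n f) = rot Q n (dend_val n f)"
      by (auto simp: sels abs_simps dend_val_abs free_rot_closed val_rot elim!: dend_spaceE)
  qed
qed

text \<open>
  Trees are generated from corollas under composition alone, so uniqueness holds among all operad
  morphisms; compatibility with \<open>\<tau>\<close> is not needed for it.
\<close>

lemma dend_val_unique:
  assumes "ns_operad_morphism Dend Q \<psi>" and L: "\<psi> 2 dend_L = a" and R: "\<psi> 2 dend_R = b"
  shows "\<psi> = dend_val"
proof -
  interpret M: ns_operad_morphism Dend Q \<psi> by fact
  interpret V: anticyclic_operad_morphism Dend Q dend_val
    by (rule anticyclic_operad_morphism_dend_val)
  have sels: "space Dend = dend_space" "scale Dend = dend_scale" "unit Dend = dend_unit"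
    "comp Dend = (\<lambda>m n. dend_comp)"
    by (simp_all add: Dend_def)
  have sp: "abs_dend (basis t) \<in> space Dend (size1 t)" for t
    unfolding sels by (intro dend_spaceI basis_in_space)
  have gen: "\<psi> 2 (abs_dend (corolla x)) = gen_val x" for x
    using L R by (cases x) (simp_all add: dend_L.abs_eq dend_R.abs_eq)
  have tree: "\<psi> (size1 t) (abs_dend (basis t)) = tree_val t" for t
  proof (induction t)
    case Leaf
    show ?case using M.map_unit by (simp add: sels dend_unit.abs_eq)
  next
    case (Node l x r)
    let ?c = "abs_dend (corolla x)" and ?r = "abs_dend (basis r)" and ?l = "abs_dend (basis l)"
    let ?X = "comp Dend 2 (size1 r) 2 ?c ?r"
    have c: "?c \<in> space Dend 2"
      using sp[of "\<langle>\<langle>\<rangle>, x, \<langle>\<rangle>\<rangle>"] by (simp add: numeral_2_eq_2)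
    have X: "?X \<in> space Dend (size1 r + 1)"
      using M.source.comp_closed[OF c sp, of 2 r] by simp
    have "\<psi> (size1 r + 1) ?X = comp Q 2 (size1 r) 2 (gen_val x) (tree_val r)"
      using M.map_comp[OF c sp, of 2 r] by (simp add: gen Node.IH)
    then have "\<psi> (size1 r + 1 + size1 l - 1) (comp Dend (size1 r + 1) (size1 l) 1 ?X ?l) =
        tree_val \<langle>l, x, r\<rangle>"
      using M.map_comp[OF X sp, of 1 l] by (simp add: Node.IH)
    moreover have "comp Dend (size1 r + 1) (size1 l) 1 ?X ?l = abs_dend (basis \<langle>l, x, r\<rangle>)"
      by (simp add: sels abs_simps free_comp_basis)
    ultimately show ?case by (simp add: add.commute)
  qed
  have val: "\<psi> n (abs_dend x) = val n x" if "x \<in> free_space n" "1 \<le> n" for n x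
    using that(1)
  proof (induction x rule: free_space_induct)
    case zero
    have "\<psi> n (0 + 0) = \<psi> n 0 + \<psi> n 0"
      by (rule M.map_add) (use that M.source.subspace_space M.source.subspace_0 in blast)+
    then have "\<psi> n 0 = 0" by simp
    then show ?case by (simp add: zero_dend.abs_eq)
  next
    case (add x y)
    then show ?case
      using M.map_add[of n "abs_dend x" "abs_dend y"] that(2)
      by (simp add: sels abs_simps dend_spaceI val_add)
  next
    case (basis c t)
    then show ?case
      using M.map_scale[of n "abs_dend (basis t)" c] sp[of t] tree[of t] that(2)
      by (auto simp: sels abs_simps val_scale val_basis)
  qed
  show ?thesis
  proof (rule PiE_ext[OF M.maps V.maps])
    fix n :: nat
    assume n: "n \<in> {1..}"
    have "\<psi> n \<in> space Dend n \<rightarrow>\<^sub>E space Q n" "dend_val n \<in> space Dend n \<rightarrow>\<^sub>E space Q n"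
      using M.maps V.maps n by (auto dest: PiE_mem)
    then show "\<psi> n = dend_val n"
    proof (rule PiE_ext)
      fix f
      assume "f \<in> space Dend n"
      then show "\<psi> n f = dend_val n f"
        using n by (auto simp: sels val dend_val_abs elim!: dend_spaceE)
    qed
  qed
qed

theorem dend_universal_property:
  "\<exists>!\<psi>. anticyclic_operad_morphism Dend Q \<psi> \<and> \<psi> 2 dend_L = a \<and> \<psi> 2 dend_R = b"
proof (rule ex1I)
  show "anticyclic_operad_morphism Dend Q dend_val \<and> dend_val 2 dend_L = a \<and> dend_val 2 dend_R = b"
    using anticyclic_operad_morphism_dend_val dend_val_generators by blast
next
  fix \<psi>
  assume *: "anticyclic_operad_morphism Dend Q \<psi> \<and> \<psi> 2 dend_L = a \<and> \<psi> 2 dend_R = b"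
  then have "ns_operad_morphism Dend Q \<psi>"
    by (simp add: anticyclic_operad_morphism_def)
  with * show "\<psi> = dend_val" by (simp add: dend_val_unique)
qed

end


section \<open>The dendriform relations in \<open>Mould\<close>\<close>

lemma usum_interval_nonzero:
  assumes "1 \<le> i" "i \<le> j"
  shows "usum i j \<noteq> 0"
proof -
  have "subst (ssub i) (usum 1 (j - i + 1)) = usum i j"
    using assms ssub_usum[of i 1 "j - i + 1"] by (simp add: subst_usum good_ssub)
  moreover have "usum 1 (j - i + 1) \<noteq> 0"
    by (rule usum_nonzero) simp
  ultimately show ?thesis
    using subst_eq_0_iff[OF good_ssub[OF assms(1)]] by metis
qed

lemma dendriform_pair_Mould:
  "dendriform_pair Mould (1 / (u 1 * (u 1 + u 2))) (1 / ((u 1 + u 2) * u 2))"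
proof -
  let ?L = "1 / (u 1 * (u 1 + u 2))" and ?R = "1 / ((u 1 + u 2) * u 2)"
  interpret M: anticyclic_operad Mould by (rule anticyclic_operad_Mould)
  have us: "usum 1 2 = u 1 + u 2" "usum 2 3 = u 2 + u 3"
    by (simp_all add: usum_def numeral_2_eq_2 numeral_3_eq_3)
  have "usum 1 3 = u 1 + u 2 + u 3"
    by (simp add: usum_def numeral_2_eq_2 numeral_3_eq_3)
  with us usum_interval_nonzero[of 1 2] usum_interval_nonzero[of 2 3] usum_interval_nonzero[of 1 3]
  have nz: "u 1 \<noteq> 0" "u 2 \<noteq> 0" "u 3 \<noteq> 0" "u 1 + u 2 \<noteq> 0" "u 2 + u 3 \<noteq> 0" "u 1 + u 2 + u 3 \<noteq> 0"
    using u_nonzero by auto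
  have csub: "csub 1 2 1 = u 1 + u 2" "csub 1 2 2 = u 3" "csub 2 2 1 = u 1" "csub 2 2 2 = u 2 + u 3"
    unfolding us[symmetric] by (simp_all add: csub_def numeral_2_eq_2 numeral_3_eq_3)
  have ssub: "ssub 1 1 = u 1" "ssub 1 2 = u 2" "ssub 2 1 = u 2" "ssub 2 2 = u 3"
    by (simp_all add: ssub_def numeral_2_eq_2 numeral_3_eq_3)
  have rsub: "rsub 2 1 = - (u 1 + u 2)" "rsub 2 2 = u 1"
    using us by (simp_all add: rsub_def)
  have good: "good_subst (csub 1 2)" "good_subst (csub 2 2)" "good_subst (ssub 1)"
    "good_subst (ssub 2)" "good_subst (rsub 2)"
    by (simp_all add: good_csub good_ssub good_rsub)
  note subs = good[THEN subst_divide] good[THEN subst_mult] good[THEN subst_add]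
  have comp: "mould_comp 2 2 1 f g = (u 1 + u 2) * subst (csub 1 2) f * subst (ssub 1) g"
    "mould_comp 2 2 2 f g = (u 2 + u 3) * subst (csub 2 2) f * subst (ssub 2) g" for f g
    unfolding us[symmetric] by (simp_all add: mould_comp_altdef numeral_2_eq_2 numeral_3_eq_3)
  have sum: "?L + ?R = 1 / (u 1 * u 2)"
  proof -
    have "1 / (x * s) + 1 / (s * y) = (x + y) / (s * (x * y))"
      if "x \<noteq> 0" "y \<noteq> 0" "s \<noteq> 0" for x y s :: ratfun
      using that by (simp add: field_simps)
    from this[OF nz(1,2,4)] nz(4) show ?thesis by simp
  qed
  have L: "subst (csub 1 2) ?L = 1 / ((u 1 + u 2) * (u 1 + u 2 + u 3))"
    "subst (csub 2 2) ?L = 1 / (u 1 * (u 1 + u 2 + u 3))"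
    "subst (ssub 1) ?L = 1 / (u 1 * (u 1 + u 2))"
    "subst (ssub 2) ?L = 1 / (u 2 * (u 2 + u 3))"
    by (simp_all add: subs csub ssub add_ac del: One_nat_def)
  have R: "subst (csub 1 2) ?R = 1 / ((u 1 + u 2 + u 3) * u 3)"
    "subst (csub 2 2) ?R = 1 / ((u 1 + u 2 + u 3) * (u 2 + u 3))"
    "subst (ssub 1) ?R = 1 / ((u 1 + u 2) * u 2)"
    "subst (ssub 2) ?R = 1 / ((u 2 + u 3) * u 3)"
    by (simp_all add: subs csub ssub add_ac del: One_nat_def)
  have S: "subst (ssub 1) (1 / (u 1 * u 2)) = 1 / (u 1 * u 2)"
    "subst (ssub 2) (1 / (u 1 * u 2)) = 1 / (u 2 * u 3)"
    by (simp_all add: subs ssub del: One_nat_def)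
  have rot: "mould_rot 2 ?L = 1 / (- (u 1 + u 2) * (- (u 1 + u 2) + u 1))"
    "mould_rot 2 ?R = 1 / ((- (u 1 + u 2) + u 1) * u 1)"
    by (simp_all only: mould_rot_altdef subs subst_01 subst_u rsub)
  have neg: "- (u 1 + u 2) * (- (u 1 + u 2) + u 1) = (u 1 + u 2) * u 2"
    "(- (u 1 + u 2) + u 1) * u 1 = - (u 1 * u 2)"
    by (simp_all add: algebra_simps)
  show ?thesis
  proof unfold_locales
    show "?L \<in> space Mould 2" "?R \<in> space Mould 2"
      by (auto simp: Mould_def intro!: mould_divide mould_closed mould_u)
    show "comp Mould 2 2 1 ?L (?L + ?R) = comp Mould 2 2 2 ?L ?L"
      unfolding Mould_def operad.select_convs sum comp L S using nz by simp
    show "comp Mould 2 2 1 ?R ?L = comp Mould 2 2 2 ?L ?R"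
      unfolding Mould_def operad.select_convs comp L R using nz by simp
    show "comp Mould 2 2 1 ?R ?R = comp Mould 2 2 2 ?R (?L + ?R)"
      unfolding Mould_def operad.select_convs sum comp R S using nz by simp
    show "rot Mould 2 ?L = ?R"
      unfolding Mould_def anticyclic.select_convs rot neg ..
    show "rot Mould 2 ?R = - (?L + ?R)"
      unfolding Mould_def anticyclic.select_convs rot neg sum by simp
  qed
qed

theorem theorem3p1:
  shows "\<exists>!\<psi>. anticyclic_operad_morphism Dend Mould \<psi> \<and>
    \<psi> 2 dend_L = 1 / (u 1 * (u 1 + u 2)) \<and>
    \<psi> 2 dend_R = 1 / ((u 1 + u 2) * u 2)"
  by (rule dendriform_pair.dend_universal_property[OF dendriform_pair_Mould])

end
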